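(* Assume $\beta^2>\alpha>1$ and $l=c\log n$ for a constant $c$ with $c\log\alpha<1/4$, and let $(H,\sigma)\sim\mathcal H(n,d,p_n,q_n)$. There exist constants $C,\gamma>0$ such that for all sufficiently large $n$, with probability at least $1-O(n^{-\gamma})$, the following hold for all $i\in[n]$ and all $1\le t\le l$: $$S_t(i)\le C\log(n)\alpha^t,\qquad |D_t(i)|\le C\log(n)\beta^t,$$ $$S_t(i)=\alpha^{t-l}S_l(i)+O(\log(n)\alpha^{t/2}),\qquad D_t(i)=\beta^{t-l}D_l(i)+O(\log(n)\alpha^{t/2}).$$
   Context: Fix an integer $d\ge3$ and constants $a\ge b>0$; $p_n=a/\binom{n}{d-1}$, $q_n=b/\binom{n}{d-1}$. Under $\mathcal H(n,d,p_n,q_n)$, $\sigma\in\{-1,+1\}^n$ has i.i.d. uniform entries, and given $\sigma$ each $d$-subset $e\subset[n]$ is independently a hyperedge of the $d$-uniform hypergraph $H$ on $[n]$ with probability $p_n$ if all spins in $e$ agree and $q_n$ otherwise. $\alpha=(d-1)\frac{a+(2^{d-1}-1)b}{2^{d-1}}$, $\beta=(d-1)\frac{a-b}{2^{d-1}}$. A walk of length $l$ is $(i_0,e_1,i_1,\dots,e_l,i_l)$ with hyperedges $e_j$ of $H$, $i_{j-1}\ne i_j$ and $\{i_{j-1},i_j\}\subset e_j$. The distance $d(i,j)$ is the minimal length of a walk from $i$ to $j$ ($d(i,i)=0$). $V_t(i)=\{j:d(i,j)=t\}$, $S_t(i)=|V_t(i)|$, $D_t(i)=\sum_{j:d(i,j)=t}\sigma_j$.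 *)

theory Defs
  imports "HOL-Probability.Probability"
begin

definition dsubsets :: "nat \<Rightarrow> nat \<Rightarrow> nat set set" where
  "dsubsets n d = {e. e \<subseteq> {1..n} \<and> card e = d}"

definition pn :: "nat \<Rightarrow> nat \<Rightarrow> real \<Rightarrow> real" where
  "pn n d a = a / real (n choose (d - 1))"

definition spins_agree :: "(nat \<Rightarrow> int) \<Rightarrow> nat set \<Rightarrow> bool" where
  "spins_agree \<sigma> e \<longleftrightarrow> (\<forall>i\<in>e. \<forall>j\<in>e. \<sigma> i = \<sigma> j)"

definition HSBM :: "nat \<Rightarrow> nat \<Rightarrow> real \<Rightarrow> real \<Rightarrow> ((nat \<Rightarrow> int) \<times> nat set set) pmf" where
  "HSBM n d a b =
     do { \<sigma> \<leftarrow> pmf_of_set (PiE {1..n} (\<lambda>_. {-1, 1::int}));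
          f \<leftarrow> Pi_pmf (dsubsets n d) False
                 (\<lambda>e. bernoulli_pmf (if spins_agree \<sigma> e then pn n d a else pn n d b));
          return_pmf (\<sigma>, {e \<in> dsubsets n d. f e}) }"

definition alpha :: "nat \<Rightarrow> real \<Rightarrow> real \<Rightarrow> real" where
  "alpha d a b = (real d - 1) * (a + (2 ^ (d - 1) - 1) * b) / 2 ^ (d - 1)"

definition beta :: "nat \<Rightarrow> real \<Rightarrow> real \<Rightarrow> real" where
  "beta d a b = (real d - 1) * (a - b) / 2 ^ (d - 1)"

definition walk_exists :: "nat set set \<Rightarrow> nat \<Rightarrow> nat \<Rightarrow> nat \<Rightarrow> bool" where
  "walk_exists H i j l \<longleftrightarrow>
     (\<exists>x :: nat \<Rightarrow> nat. x 0 = i \<and> x l = j \<and>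
        (\<forall>k<l. x k \<noteq> x (Suc k) \<and> (\<exists>e\<in>H. {x k, x (Suc k)} \<subseteq> e)))"

definition Vt :: "nat set set \<Rightarrow> nat \<Rightarrow> nat \<Rightarrow> nat set" where
  "Vt H i t = {j. walk_exists H i j t \<and> (\<forall>s<t. \<not> walk_exists H i j s)}"

definition St :: "nat set set \<Rightarrow> nat \<Rightarrow> nat \<Rightarrow> nat" where
  "St H i t = card (Vt H i t)"

definition Dt :: "(nat \<Rightarrow> int) \<Rightarrow> nat set set \<Rightarrow> nat \<Rightarrow> nat \<Rightarrow> int" where
  "Dt \<sigma> H i t = (\<Sum>j\<in>Vt H i t. \<sigma> j)"

end

theory Submission
  imports Defs "HOL-Real_Asymp.Real_Asymp"
begin

text \<open>The spheres around a vertex are exposed one at a time. The spheres up to radius \<open>t\<close> are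
  determined by the edges that meet the ball of radius \<open>t - 1\<close>, so given that ball \<open>U\<close> and the
  sphere \<open>A\<close> of radius \<open>t\<close>, the next sphere is built from the independent edges that meet \<open>A\<close> and
  avoid \<open>U\<close>. Up to collisions its size and its spin sum are sums of independent bounded terms, with
  means close to \<open>\<alpha>\<close> times the size and \<open>\<beta>\<close> times the spin sum of \<open>A\<close> whenever the spins are globally
  balanced. A Chernoff bound gives an error of order \<open>ln n * \<alpha> powr (t / 2)\<close> in one step, with failure
  probability \<open>O(n powr -3)\<close>, as long as the size of \<open>A\<close> is \<open>O(ln n * \<alpha> ^ t)\<close>. This condition reproduces
  itself for a suitable constant, and since \<open>\<beta>\<^sup>2 > \<alpha>\<close> the one-step errors, discounted by powers of \<open>\<alpha>\<close>
  or \<open>\<beta>\<close>, add up to a geometric series.\<close>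

section \<open>Independent coordinates of a product measure\<close>

text \<open>Two obstacles shape the proof. The next sphere is exposed from a random set, and its
  size is not a sum of independent terms, since several edges can reach one vertex. The first is met
  by summing over the possible values of the exposed data (\<open>Pi_pmf_adapted\<close>), so that
  the one-step estimate is needed only for deterministic \<open>U\<close> and \<open>A\<close>. The
  second is met by an exponential moment of the repetition count \<open>excess\<close>: colliding
  pairs of fresh edges have an expected number of order (card A)^2 / n, which stays bounded. The
  condition \<open>c * ln \<alpha> < 1 / 4\<close> keeps the whole ball at O(ln n * n powr (1/4)).
  Its square, and its product with a spin imbalance of order sqrt (n * ln n), are then below n,
  which makes the total bias of the means O(1). Up to an additive constant, the error of a step is
  proportional to the square root of the assumed sphere bound. A large enough constant therefore
  dominates the error it generates, and the bootstrap closes. A step fails with probability O(n powr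
  -3), which pays for n centres and at most n radii and leaves O(n powr -1).\<close>

lemma finite_set_Pi_pmf:
  assumes "finite A" "\<And>e. e \<in> A \<Longrightarrow> finite (set_pmf (p e))"
  shows "finite (set_pmf (Pi_pmf A dflt p))"
  using assms by (subst set_Pi_pmf) (auto intro!: finite_PiE_dflt)

section \<open>Exponential moments and Chernoff bounds\<close>

lemma exp_le_1_x_x2:
  fixes x :: real
  assumes "\<bar>x\<bar> \<le> 1"
  shows "exp x \<le> 1 + x + x\<^sup>2"
proof (cases "x \<ge> 0")
  case True
  then show ?thesis using exp_bound[of x] assms by auto
next
  case False
  define y where "y = - x"
  have y: "0 \<le> y" "y \<le> 1" using False assms by (auto simp: y_def)
  have "1 + y \<le> exp y" by (rule exp_ge_add_one_self)
  hence "exp x \<le> 1 / (1 + y)" using y by (simp add: y_def exp_minus field_simps)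
  also have "\<dots> \<le> 1 - y + y\<^sup>2"
  proof -
    have "(1 - y + y\<^sup>2) * (1 + y) = 1 + y ^ 3" by (simp add: power2_eq_square power3_eq_cube algebra_simps)
    then show ?thesis using y by (simp add: pos_divide_le_eq)
  qed
  finally show ?thesis by (simp add: y_def)
qed

lemma pmf_markov:
  fixes X :: "'a \<Rightarrow> real"
  assumes "finite (set_pmf M)"
  shows "measure_pmf.prob M {x. X x \<ge> t} \<le> measure_pmf.expectation M (\<lambda>x. exp (X x)) * exp (- t)"
proof -
  have "measure_pmf.prob M {x. X x \<ge> t} = measure_pmf.expectation M (indicator {x. X x \<ge> t})"
    by simp
  also have "\<dots> \<le> measure_pmf.expectation M (\<lambda>x. exp (X x) * exp (- t))"
    by (intro integral_mono integrable_measure_pmf_finite assms)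
       (auto simp: indicator_def simp flip: exp_add)
  also have "\<dots> = measure_pmf.expectation M (\<lambda>x. exp (X x)) * exp (- t)" by simp
  finally show ?thesis .
qed

text \<open>The exponential parameter is fixed at 1, and a caller tunes the tail by rescaling
  \<open>g\<close>. Terms of size at most 1 obey \<open>exp_le_1_x_x2\<close>, so each factor of the
  moment generating function is at most the exponential of its mean plus its uncentred second
  moment.\<close>

lemma Pi_pmf_chernoff:
  fixes g :: "'a \<Rightarrow> 'b \<Rightarrow> real"
  assumes fin: "finite A" and fin': "\<And>e. e \<in> A \<Longrightarrow> finite (set_pmf (p e))"
    and bnd: "\<And>e x. e \<in> A \<Longrightarrow> x \<in> set_pmf (p e) \<Longrightarrow> \<bar>g e x\<bar> \<le> 1"
  shows "measure_pmf.prob (Pi_pmf A dflt p)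
           {f. (\<Sum>e\<in>A. g e (f e)) - (\<Sum>e\<in>A. measure_pmf.expectation (p e) (g e)) \<ge> \<tau>}
         \<le> exp ((\<Sum>e\<in>A. measure_pmf.expectation (p e) (\<lambda>x. (g e x)\<^sup>2)) - \<tau>)" (is "?P \<le> _")
proof -
  let ?m = "\<Sum>e\<in>A. measure_pmf.expectation (p e) (g e)"
  let ?v = "\<Sum>e\<in>A. measure_pmf.expectation (p e) (\<lambda>x. (g e x)\<^sup>2)"
  have "?P = measure_pmf.prob (Pi_pmf A dflt p) {f. (\<Sum>e\<in>A. g e (f e)) \<ge> \<tau> + ?m}"
    by (simp add: algebra_simps)
  also have "\<dots> \<le> measure_pmf.expectation (Pi_pmf A dflt p) (\<lambda>f. exp (\<Sum>e\<in>A. g e (f e))) * exp (- (\<tau> + ?m))"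
    by (rule pmf_markov) (intro finite_set_Pi_pmf fin fin')
  also have "measure_pmf.expectation (Pi_pmf A dflt p) (\<lambda>f. exp (\<Sum>e\<in>A. g e (f e)))
     = measure_pmf.expectation (Pi_pmf A dflt p) (\<lambda>f. \<Prod>e\<in>A. exp (g e (f e)))"
    by (simp add: exp_sum fin)
  also have "\<dots> = (\<Prod>e\<in>A. measure_pmf.expectation (p e) (\<lambda>x. exp (g e x)))"
    by (intro expectation_prod_Pi_pmf fin integrable_measure_pmf_finite fin') auto
  also have "\<dots> \<le> (\<Prod>e\<in>A. exp (measure_pmf.expectation (p e) (g e) + measure_pmf.expectation (p e) (\<lambda>x. (g e x)\<^sup>2)))"
  proof (intro prod_mono conjI)
    fix e assume e: "e \<in> A"
    note int = integrable_measure_pmf_finite[OF fin'[OF e]]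
    show "0 \<le> measure_pmf.expectation (p e) (\<lambda>x. exp (g e x))" by simp
    have "measure_pmf.expectation (p e) (\<lambda>x. exp (g e x))
          \<le> measure_pmf.expectation (p e) (\<lambda>x. 1 + g e x + (g e x)\<^sup>2)"
      by (intro integral_mono_AE int AE_pmfI exp_le_1_x_x2 bnd e)
    also have "\<dots> = 1 + (measure_pmf.expectation (p e) (g e) + measure_pmf.expectation (p e) (\<lambda>x. (g e x)\<^sup>2))"
      by (simp add: int)
    also have "\<dots> \<le> exp (measure_pmf.expectation (p e) (g e) + measure_pmf.expectation (p e) (\<lambda>x. (g e x)\<^sup>2))"
      by (rule exp_ge_add_one_self)
    finally show "measure_pmf.expectation (p e) (\<lambda>x. exp (g e x)) \<le> \<dots>" .
  qed
  also have "\<dots> = exp (?m + ?v)" by (simp only: exp_sum[OF fin] sum.distrib[symmetric])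
  finally show ?thesis by (simp flip: exp_add)
qed

lemma Pi_pmf_chernoff_abs:
  fixes g :: "'a \<Rightarrow> 'b \<Rightarrow> real"
  assumes fin: "finite A" and fin': "\<And>e. e \<in> A \<Longrightarrow> finite (set_pmf (p e))"
    and bnd: "\<And>e x. e \<in> A \<Longrightarrow> x \<in> set_pmf (p e) \<Longrightarrow> \<bar>g e x\<bar> \<le> 1"
  shows "measure_pmf.prob (Pi_pmf A dflt p)
           {f. \<bar>(\<Sum>e\<in>A. g e (f e)) - (\<Sum>e\<in>A. measure_pmf.expectation (p e) (g e))\<bar> \<ge> \<tau>}
         \<le> 2 * exp ((\<Sum>e\<in>A. measure_pmf.expectation (p e) (\<lambda>x. (g e x)\<^sup>2)) - \<tau>)" (is "measure_pmf.prob ?M ?S \<le> 2 * ?b")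
proof -
  let ?S1 = "{f. (\<Sum>e\<in>A. g e (f e)) - (\<Sum>e\<in>A. measure_pmf.expectation (p e) (g e)) \<ge> \<tau>}"
  let ?S2 = "{f. (\<Sum>e\<in>A. - g e (f e)) - (\<Sum>e\<in>A. measure_pmf.expectation (p e) (\<lambda>x. - g e x)) \<ge> \<tau>}"
  have "measure_pmf.prob ?M ?S \<le> measure_pmf.prob ?M (?S1 \<union> ?S2)"
    by (intro measure_pmf.finite_measure_mono) (auto simp: sum_negf abs_if split: if_splits)
  also have "\<dots> \<le> measure_pmf.prob ?M ?S1 + measure_pmf.prob ?M ?S2"
    by (rule measure_Un_le) auto
  also have "measure_pmf.prob ?M ?S1 \<le> ?b"
    by (intro Pi_pmf_chernoff assms)
  also have "measure_pmf.prob ?M ?S2 \<le> ?b"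
    using Pi_pmf_chernoff[of A p "\<lambda>e x. - g e x" dflt \<tau>] assms by simp
  finally show ?thesis by simp
qed

section \<open>Independence and conditioning on exposed coordinates\<close>

lemma measure_pair_pmf_Times:
  "measure_pmf.prob (pair_pmf M N) (X \<times> Y) = measure_pmf.prob M X * measure_pmf.prob N Y"
proof -
  \<comment> \<open>Intersecting with the supports makes both sides of the rectangle
    countable.\<close>
  have "measure_pmf.prob (pair_pmf M N) (X \<times> Y)
      = measure_pmf.prob (pair_pmf M N) ((X \<inter> set_pmf M) \<times> (Y \<inter> set_pmf N))"
    by (intro measure_prob_cong_0) (auto simp: set_pmf_eq pmf_pair)
  also have "\<dots> = measure_pmf.prob M (X \<inter> set_pmf M) * measure_pmf.prob N (Y \<inter> set_pmf N)"
    by (intro measure_pmf_prob_product) (auto intro: countable_subset[OF _ countable_set_pmf])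
  finally show ?thesis by (simp add: measure_Int_set_pmf)
qed

lemma Pi_pmf_indep_events:
  assumes fin: "finite A" and S: "S \<subseteq> A"
    and P: "\<And>f g. (\<And>e. e \<in> S \<Longrightarrow> f e = g e) \<Longrightarrow> P f = P g"
    and Q: "\<And>f g. (\<And>e. e \<in> A - S \<Longrightarrow> f e = g e) \<Longrightarrow> Q f = Q g"
  shows "measure_pmf.prob (Pi_pmf A dflt p) {f. P f \<and> Q f} =
         measure_pmf.prob (Pi_pmf A dflt p) {f. P f} * measure_pmf.prob (Pi_pmf A dflt p) {f. Q f}"
proof -
  let ?h = "\<lambda>(f, g) x. if x \<in> S then f x else g x"
  let ?M1 = "Pi_pmf S dflt p" and ?M2 = "Pi_pmf (A - S) dflt p"
  have fS: "finite S" using fin S by (rule rev_finite_subset)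
  have "Pi_pmf A dflt p = Pi_pmf (S \<union> (A - S)) dflt p" using S by (simp add: Un_absorb1)
  also have "\<dots> = map_pmf ?h (pair_pmf ?M1 ?M2)" using fin fS by (intro Pi_pmf_union) auto
  finally have eq: "Pi_pmf A dflt p = map_pmf ?h (pair_pmf ?M1 ?M2)" .
  \<comment> \<open>Stated for arbitrary \<open>P'\<close> and \<open>Q'\<close>, so that taking one
    of them constantly true also computes the two marginals.\<close>
  have *: "measure_pmf.prob (Pi_pmf A dflt p) {f. P' f \<and> Q' f} =
     measure_pmf.prob ?M1 {f. P' f} * measure_pmf.prob ?M2 {f. Q' f}"
    if P': "\<And>f g. (\<And>e. e \<in> S \<Longrightarrow> f e = g e) \<Longrightarrow> P' f = P' g"
    and Q': "\<And>f g. (\<And>e. e \<in> A - S \<Longrightarrow> f e = g e) \<Longrightarrow> Q' f = Q' g" for P' Q'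
  proof -
    have "?h -` {f. P' f \<and> Q' f} = {f. P' f} \<times> {f. Q' f}"
    proof (intro set_eqI, clarify)
      fix f g
      have "P' (?h (f, g)) = P' f" by (rule P') auto
      moreover have "Q' (?h (f, g)) = Q' g" by (rule Q') auto
      ultimately show "((f, g) \<in> ?h -` {f. P' f \<and> Q' f}) = ((f, g) \<in> {f. P' f} \<times> {f. Q' f})"
        by simp
    qed
    then show ?thesis
      unfolding eq measure_map_pmf by (simp only: measure_pair_pmf_Times)
  qed
  have 1: "measure_pmf.prob (Pi_pmf A dflt p) {f. P f} = measure_pmf.prob ?M1 {f. P f}"
  proof -
    have "measure_pmf.prob (Pi_pmf A dflt p) {f. P f \<and> True} =
      measure_pmf.prob ?M1 {f. P f} * measure_pmf.prob ?M2 {f. True}"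
      by (rule *[OF P]) simp_all
    then show ?thesis by simp
  qed
  have 2: "measure_pmf.prob (Pi_pmf A dflt p) {f. Q f} = measure_pmf.prob ?M2 {f. Q f}"
  proof -
    have "measure_pmf.prob (Pi_pmf A dflt p) {f. True \<and> Q f} =
      measure_pmf.prob ?M1 {f. True} * measure_pmf.prob ?M2 {f. Q f}"
      by (rule *[OF _ Q]) simp_all
    then show ?thesis by simp
  qed
  show ?thesis unfolding 1 2 by (rule *[OF P Q])
qed

text \<open>\<open>S (T f)\<close> acts as a stopping set: the revealed value \<open>T f\<close> is
  decided by the coordinates that it declares to be exposed. On the event \<open>T f = u\<close> the
  coordinates outside \<open>S u\<close> are still fresh, so a bound that holds for every fixed
  \<open>u\<close> survives the substitution of the random value.\<close>

lemma Pi_pmf_adapted: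
  fixes T :: "('a \<Rightarrow> 'b) \<Rightarrow> 's"
  assumes fin: "finite A" and fin': "\<And>e. e \<in> A \<Longrightarrow> finite (set_pmf (p e))"
    and S: "\<And>u. S u \<subseteq> A"
    and T: "\<And>f g. (\<And>e. e \<in> S (T f) \<Longrightarrow> f e = g e) \<Longrightarrow> T g = T f"
    and B: "\<And>u f g. (\<And>e. e \<in> A - S u \<Longrightarrow> f e = g e) \<Longrightarrow> B u f = B u g"
    and le: "\<And>u. measure_pmf.prob (Pi_pmf A dflt p) {f. B u f} \<le> \<delta>"
  shows "measure_pmf.prob (Pi_pmf A dflt p) {f. B (T f) f} \<le> \<delta>"
proof -
  let ?M = "Pi_pmf A dflt p"
  let ?X = "T ` set_pmf ?M"
  have finX: "finite ?X" by (intro finite_imageI finite_set_Pi_pmf fin fin')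
  have split: "measure_pmf.prob ?M {f. R (T f) f} = (\<Sum>u\<in>?X. measure_pmf.prob ?M {f. T f = u \<and> R u f})" for R
  proof -
    have "measure_pmf.prob ?M {f. R (T f) f} = measure_pmf.prob ?M (\<Union>u\<in>?X. {f. T f = u \<and> R u f})"
      by (intro measure_prob_cong_0) (auto simp: set_pmf_eq)
    also have "\<dots> = (\<Sum>u\<in>?X. measure_pmf.prob ?M {f. T f = u \<and> R u f})"
      by (intro measure_pmf.finite_measure_finite_Union finX) (auto simp: disjoint_family_on_def)
    finally show ?thesis .
  qed
  have ind: "measure_pmf.prob ?M {f. T f = u \<and> B u f} =
        measure_pmf.prob ?M {f. T f = u} * measure_pmf.prob ?M {f. B u f}" for u
  proof (rule Pi_pmf_indep_events[OF fin S[of u] _ B])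
    fix f g :: "'a \<Rightarrow> 'b" assume "\<And>e. e \<in> S u \<Longrightarrow> f e = g e"
    \<comment> \<open>Whichever of the two functions has the value \<open>u\<close>, agreement on
      \<open>S u\<close> transfers it to the other; hence both instances.\<close>
    with T[of f g] T[of g f] show "(T f = u) = (T g = u)" by metis
  qed auto
  have "measure_pmf.prob ?M {f. B (T f) f} = (\<Sum>u\<in>?X. measure_pmf.prob ?M {f. T f = u} * measure_pmf.prob ?M {f. B u f})"
    by (simp add: split ind)
  also have "\<dots> \<le> (\<Sum>u\<in>?X. measure_pmf.prob ?M {f. T f = u} * \<delta>)"
    by (intro sum_mono mult_left_mono le) auto
  also have "\<dots> = measure_pmf.prob ?M {f. True} * \<delta>"
    using split[of "\<lambda>_ _. True"] by (simp flip: sum_distrib_right)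
  finally show ?thesis by simp
qed

text \<open>Separates the spins from the edges: \<open>Bd\<close> will be the set of unbalanced spin
  vectors, whose probability is paid for once, while all others share the conditional bound
  \<open>\<delta>\<close>.\<close>

lemma prob_bind_pmf_le:
  assumes le: "\<And>x. x \<in> set_pmf M \<Longrightarrow> x \<notin> Bd \<Longrightarrow> measure_pmf.prob (f x) X \<le> \<delta>"
    and fin: "finite (set_pmf M)" and "\<delta> \<ge> 0"
  shows "measure_pmf.prob (bind_pmf M f) X \<le> measure_pmf.prob M Bd + \<delta>"
proof -
  have "ennreal (measure_pmf.prob (bind_pmf M f) X) = emeasure (bind_pmf M f) X"
    by (simp add: measure_pmf.emeasure_eq_measure)
  also have "\<dots> = (\<integral>\<^sup>+x. emeasure (f x) X \<partial>M)" by simp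
  also have "\<dots> \<le> (\<integral>\<^sup>+x. (indicator Bd x + ennreal \<delta>) \<partial>M)"
  proof (intro nn_integral_mono_AE AE_pmfI)
    fix x assume x: "x \<in> set_pmf M"
    have "ennreal (measure_pmf.prob (f x) X) \<le> indicator Bd x + ennreal \<delta>"
    proof (cases "x \<in> Bd")
      case True
      have "ennreal (measure_pmf.prob (f x) X) \<le> 1" by (simp add: measure_pmf.prob_le_1)
      also have "\<dots> \<le> indicator Bd x + ennreal \<delta>" using True by simp
      finally show ?thesis .
    next
      case False
      then show ?thesis using le[OF x False] by (simp add: ennreal_leI)
    qed
    then show "emeasure (f x) X \<le> indicator Bd x + ennreal \<delta>"
      by (simp add: measure_pmf.emeasure_eq_measure)
  qed
  also have "\<dots> = ennreal (measure_pmf.prob M Bd + \<delta>)"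
    using \<open>\<delta> \<ge> 0\<close> by (simp add: nn_integral_add measure_pmf.emeasure_eq_measure ennreal_plus)
  finally show ?thesis
    by (rule ennreal_le_iff[THEN iffD1, rotated]) (use \<open>\<delta> \<ge> 0\<close> in \<open>simp add: add_nonneg_nonneg\<close>)
qed

section \<open>Collisions\<close>

text \<open>The number of repetitions when the sets \<open>\<phi> e\<close> are laid on top of
  \<open>W\<close>. The ground set \<open>W\<close> is there for the induction, which moves the
  vertices of a revealed edge into it; the application starts from the empty set.\<close>

definition excess :: "('e \<Rightarrow> 'v set) \<Rightarrow> 'v set \<Rightarrow> 'e set \<Rightarrow> real" where
  "excess \<phi> W H = real (card W) + (\<Sum>e\<in>H. real (card (\<phi> e))) - real (card (W \<union> \<Union>(\<phi> ` H)))"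

lemma excess_empty [simp]: "excess \<phi> W {} = 0"
  by (simp add: excess_def)

lemma excess_insert:
  assumes "finite H" "e \<notin> H" "finite W" "finite (\<phi> e)"
  shows "excess \<phi> W (insert e H) = real (card (\<phi> e \<inter> W)) + excess \<phi> (W \<union> \<phi> e) H"
proof -
  have "card W + card (\<phi> e) = card (W \<union> \<phi> e) + card (W \<inter> \<phi> e)"
    by (rule card_Un_Int) (use assms in auto)
  hence "real (card W) + real (card (\<phi> e)) = real (card (W \<union> \<phi> e)) + real (card (\<phi> e \<inter> W))"
    by (simp add: Int_commute flip: of_nat_add)
  then show ?thesis using assms by (simp add: excess_def Un_assoc)
qed

text \<open>A vertex covered by \<open>deg j\<close> sets is counted \<open>deg j\<close> times in
  the double sum and once in the union. Since \<open>deg j\<close> is at least 1 on the union, the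
  discrepancy of any weight bounded by 1 is dominated by the sum of \<open>deg j - 1\<close>, which
  is the excess over the empty set.\<close>

lemma sum_Union_excess:
  fixes \<tau> :: "'v \<Rightarrow> real"
  assumes fin: "finite H" "\<And>e. e \<in> H \<Longrightarrow> finite (\<phi> e)"
    and \<tau>: "\<And>j. \<bar>\<tau> j\<bar> \<le> 1"
  shows "\<bar>(\<Sum>j\<in>\<Union>(\<phi> ` H). \<tau> j) - (\<Sum>e\<in>H. \<Sum>j\<in>\<phi> e. \<tau> j)\<bar> \<le> excess \<phi> {} H"
proof -
  let ?N = "\<Union>(\<phi> ` H)"
  define deg where "deg = (\<lambda>j. real (card {e\<in>H. j \<in> \<phi> e}))"
  have finN: "finite ?N" using fin by auto
  have swap: "(\<Sum>e\<in>H. \<Sum>j\<in>\<phi> e. g j) = (\<Sum>j\<in>?N. deg j * g j)" for g :: "'v \<Rightarrow> real"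
  proof -
    have "(\<Sum>e\<in>H. \<Sum>j\<in>\<phi> e. g j) = (\<Sum>e\<in>H. \<Sum>j\<in>{j\<in>?N. j \<in> \<phi> e}. g j)"
      by (intro sum.cong refl) auto
    also have "\<dots> = (\<Sum>j\<in>?N. \<Sum>e\<in>{e\<in>H. j \<in> \<phi> e}. g j)"
      by (rule sum.swap_restrict[OF fin(1) finN])
    finally show ?thesis by (simp add: deg_def)
  qed
  have deg: "deg j \<ge> 1" if "j \<in> ?N" for j
  proof -
    have "{e\<in>H. j \<in> \<phi> e} \<noteq> {}" using that by auto
    hence "card {e\<in>H. j \<in> \<phi> e} > 0" using fin by (subst card_gt_0_iff) auto
    then show ?thesis by (simp add: deg_def)
  qed
  have "(\<Sum>j\<in>?N. \<tau> j) - (\<Sum>e\<in>H. \<Sum>j\<in>\<phi> e. \<tau> j) = (\<Sum>j\<in>?N. (1 - deg j) * \<tau> j)"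
    unfolding swap by (simp add: algebra_simps sum_subtractf)
  also have "\<bar>\<dots>\<bar> \<le> (\<Sum>j\<in>?N. \<bar>(1 - deg j) * \<tau> j\<bar>)" by (rule sum_abs)
  also have "\<dots> \<le> (\<Sum>j\<in>?N. deg j * 1 - 1)"
  proof (intro sum_mono)
    fix j assume "j \<in> ?N"
    with deg[of j] have "\<bar>(1 - deg j) * \<tau> j\<bar> = (deg j - 1) * \<bar>\<tau> j\<bar>" by (simp add: abs_mult)
    also have "\<dots> \<le> (deg j - 1) * 1" using deg[OF \<open>j \<in> ?N\<close>] \<tau> by (intro mult_left_mono) auto
    finally show "\<bar>(1 - deg j) * \<tau> j\<bar> \<le> deg j * 1 - 1" by simp
  qed
  also have "\<dots> = excess \<phi> {} H"
    unfolding sum_subtractf swap[symmetric] by (simp add: excess_def)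
  finally show ?thesis .
qed

text \<open>Reveals \<open>e\<close> before all other edges. If present, it pays for its overlap
  with \<open>W\<close> at once and then belongs to the ground set; if absent, nothing
  changes.\<close>

lemma excess_mgf_rec:
  fixes p :: "'e \<Rightarrow> real" and \<phi> :: "'e \<Rightarrow> 'v set"
  assumes "finite F" "e \<notin> F" "0 \<le> p e" "p e \<le> 1" "finite W" "finite (\<phi> e)"
  defines "M \<equiv> \<lambda>F W. measure_pmf.expectation (Pi_pmf F False (\<lambda>e. bernoulli_pmf (p e)))
                 (\<lambda>\<omega>. exp (excess \<phi> W {e\<in>F. \<omega> e}))"
  shows "M (insert e F) W = p e * exp (card (\<phi> e \<inter> W)) * M F (W \<union> \<phi> e) + (1 - p e) * M F W"
proof -
  let ?P = "\<lambda>F. Pi_pmf F False (\<lambda>e. bernoulli_pmf (p e))"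
  let ?h = "\<lambda>\<omega>. exp (excess \<phi> W {e'\<in>insert e F. \<omega> e'})"
  have fin: "finite (set_pmf (map_pmf (\<lambda>f. f(e := y)) (?P F)))" for y
    using assms(1) by (auto intro!: finite_set_Pi_pmf)
  have "?P (insert e F) = bernoulli_pmf (p e) \<bind> (\<lambda>y. map_pmf (\<lambda>f. f(e := y)) (?P F))"
    using assms by (subst Pi_pmf_insert') (simp_all add: map_pmf_def)
  hence "M (insert e F) W = (\<Sum>y\<in>UNIV. pmf (bernoulli_pmf (p e)) y *\<^sub>R
            measure_pmf.expectation (map_pmf (\<lambda>f. f(e := y)) (?P F)) ?h)"
    unfolding M_def using fin by (simp only:) (rule pmf_expectation_bind, auto)
  also have "\<dots> = p e * measure_pmf.expectation (?P F) (\<lambda>f. ?h (f(e := True)))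
       + (1 - p e) * measure_pmf.expectation (?P F) (\<lambda>f. ?h (f(e := False)))"
    using assms by (simp add: UNIV_bool)
  also have "(\<lambda>f. ?h (f(e := True))) = (\<lambda>f. exp (card (\<phi> e \<inter> W)) * exp (excess \<phi> (W \<union> \<phi> e) {e\<in>F. f e}))"
  proof
    fix f
    have "{e'\<in>insert e F. (f(e := True)) e'} = insert e {e'\<in>F. f e'}" using \<open>e \<notin> F\<close> by auto
    then show "?h (f(e := True)) = exp (card (\<phi> e \<inter> W)) * exp (excess \<phi> (W \<union> \<phi> e) {e\<in>F. f e})"
      using assms by (simp add: excess_insert exp_add)
  qed
  also have "(\<lambda>f. ?h (f(e := False))) = (\<lambda>f. exp (excess \<phi> W {e\<in>F. f e}))"
  proof
    fix f
    have "{e'\<in>insert e F. (f(e := False)) e'} = {e'\<in>F. f e'}" using \<open>e \<notin> F\<close> by auto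
    then show "?h (f(e := False)) = exp (excess \<phi> W {e\<in>F. f e})" by simp
  qed
  finally show ?thesis by (simp add: M_def)
qed

text \<open>When the edges are revealed one at a time, a revealed edge raises the intensity of later
  edges that would collide with it by at most \<open>\<eta>\<close>; the exponent is this intensity, weighted by
  \<open>\<kappa>\<close>, plus the total compensation for these increases.\<close>

lemma excess_mgf:
  fixes p :: "'e \<Rightarrow> real" and \<phi> :: "'e \<Rightarrow> 'v set"
  assumes fin: "finite F" and p: "\<And>e. e \<in> F \<Longrightarrow> 0 \<le> p e" "\<And>e. e \<in> F \<Longrightarrow> p e \<le> 1"
    and \<phi>: "\<And>e. e \<in> F \<Longrightarrow> finite (\<phi> e)" "\<And>e. e \<in> F \<Longrightarrow> card (\<phi> e) \<le> d"
    and \<eta>: "\<And>e. e \<in> F \<Longrightarrow> (\<Sum>f | f \<in> F \<and> \<phi> f \<inter> \<phi> e \<noteq> {}. p f) \<le> \<eta>" "\<eta> \<ge> 0"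
    and \<kappa>: "\<kappa> = exp (real d + 1)" "\<kappa> * \<eta> \<le> 1" and W: "finite W"
  shows "measure_pmf.expectation (Pi_pmf F False (\<lambda>e. bernoulli_pmf (p e)))
                 (\<lambda>\<omega>. exp (excess \<phi> W {e\<in>F. \<omega> e}))
         \<le> exp (\<kappa> * (\<Sum>e | e \<in> F \<and> \<phi> e \<inter> W \<noteq> {}. p e) + 2 * \<kappa> * \<eta> * (\<Sum>e\<in>F. p e))"
  using fin p \<phi> \<eta>(1) W
proof (induction F arbitrary: W rule: finite_induct)
  case empty
  then show ?case by simp
next
  case (insert e F)
  define M where "M = (\<lambda>F W. measure_pmf.expectation (Pi_pmf F False (\<lambda>e. bernoulli_pmf (p e)))
                 (\<lambda>\<omega>. exp (excess \<phi> W {e\<in>F. \<omega> e})))"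
  define I where "I = (\<lambda>F W. \<Sum>e | e \<in> F \<and> \<phi> e \<inter> W \<noteq> {}. p e)"
  define c where "c = 2 * \<kappa> * \<eta>"
  have \<kappa>0: "\<kappa> > 0" using \<kappa> by simp
  have pe: "0 \<le> p e" "p e \<le> 1" using insert.prems by auto
  have mono: "(\<Sum>f | f \<in> F \<and> \<phi> f \<inter> \<phi> e' \<noteq> {}. p f) \<le> \<eta>" if "e' \<in> insert e F" for e'
  proof -
    have "(\<Sum>f | f \<in> F \<and> \<phi> f \<inter> \<phi> e' \<noteq> {}. p f) \<le> (\<Sum>f | f \<in> insert e F \<and> \<phi> f \<inter> \<phi> e' \<noteq> {}. p f)"
      using insert by (intro sum_mono2) auto
    also have "\<dots> \<le> \<eta>" using insert.prems(5) that by simp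
    finally show ?thesis .
  qed
  have IH: "M F W' \<le> exp (\<kappa> * I F W' + c * (\<Sum>e\<in>F. p e))" if "finite W'" for W'
    unfolding M_def I_def c_def
    by (rule insert.IH) (use insert.prems mono that in auto)
  have fW: "finite W" "finite (\<phi> e)" using insert.prems by auto
  \<comment> \<open>An edge that is newly counted must meet \<open>\<phi> e\<close>, so the increase
    is what \<open>\<eta>\<close> bounds.\<close>
  have IU: "I F (W \<union> \<phi> e) \<le> I F W + \<eta>"
  proof -
    have "I F (W \<union> \<phi> e) \<le> sum p ({f. f \<in> F \<and> \<phi> f \<inter> W \<noteq> {}} \<union> {f. f \<in> F \<and> \<phi> f \<inter> \<phi> e \<noteq> {}})"
      unfolding I_def using insert by (intro sum_mono2) auto
    also have "\<dots> \<le> I F W + (\<Sum>f | f \<in> F \<and> \<phi> f \<inter> \<phi> e \<noteq> {}. p f)"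
      unfolding I_def using insert.hyps insert.prems by (subst sum_Un) (auto intro!: sum_nonneg)
    also have "\<dots> \<le> I F W + \<eta>" using mono[of e] by simp
    finally show ?thesis .
  qed
  let ?G = "exp (\<kappa> * I F W + c * (\<Sum>e\<in>F. p e))"
  have "M F (W \<union> \<phi> e) \<le> exp (\<kappa> * I F (W \<union> \<phi> e) + c * (\<Sum>e\<in>F. p e))"
    using fW by (intro IH) auto
  also have "\<dots> \<le> exp (\<kappa> * (I F W + \<eta>) + c * (\<Sum>e\<in>F. p e))"
    using IU \<kappa>0 by simp
  also have "\<dots> = ?G * exp (\<kappa> * \<eta>)" by (simp add: exp_add algebra_simps)
  finally have G2: "M F (W \<union> \<phi> e) \<le> ?G * exp (\<kappa> * \<eta>)" .
  have "M (insert e F) W = p e * exp (card (\<phi> e \<inter> W)) * M F (W \<union> \<phi> e) + (1 - p e) * M F W"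
    unfolding M_def by (intro excess_mgf_rec) (use insert.hyps pe fW in auto)
  also have "\<dots> \<le> p e * exp (card (\<phi> e \<inter> W)) * (?G * exp (\<kappa> * \<eta>)) + (1 - p e) * ?G"
    by (intro add_mono mult_left_mono G2 IH fW) (use pe in auto)
  also have "\<dots> = ?G * (1 + p e * (exp (card (\<phi> e \<inter> W) + \<kappa> * \<eta>) - 1))"
    by (simp add: algebra_simps exp_add)
  also have "\<dots> \<le> ?G * exp (p e * (exp (card (\<phi> e \<inter> W) + \<kappa> * \<eta>) - 1))"
    by (intro mult_left_mono exp_ge_add_one_self) auto
  also have "\<dots> \<le> ?G * exp (\<kappa> * (if \<phi> e \<inter> W \<noteq> {} then p e else 0) + c * p e)"
  proof (intro mult_left_mono)
    have c0: "c \<ge> 0" using \<kappa>0 \<eta> by (simp add: c_def)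
    show "exp (p e * (exp (card (\<phi> e \<inter> W) + \<kappa> * \<eta>) - 1)) \<le> exp (\<kappa> * (if \<phi> e \<inter> W \<noteq> {} then p e else 0) + c * p e)"
    \<comment> \<open>Without overlap only the growth of \<open>W\<close> costs, and
      \<open>exp y - 1 <= 2 * y\<close> at \<open>y = \<kappa> * \<eta> <= 1\<close> gives
      \<open>c\<close>. With overlap the factor is at most exp d from the overlap times exp 1 from
      \<open>\<kappa> * \<eta> <= 1\<close>; this is the origin of
      \<open>\<kappa> = exp (d + 1)\<close>.\<close>
    proof (cases "\<phi> e \<inter> W = {}")
      case True
      have k1: "0 \<le> \<kappa> * \<eta>" using \<kappa>0 \<eta> by simp
      have "exp (\<kappa> * \<eta>) \<le> 1 + \<kappa> * \<eta> + (\<kappa> * \<eta>)\<^sup>2" using exp_le_1_x_x2[of "\<kappa> * \<eta>"] \<kappa> k1 by simp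
      also have "(\<kappa> * \<eta>)\<^sup>2 \<le> \<kappa> * \<eta>"
        unfolding power2_eq_square by (rule mult_left_le) (use \<kappa> k1 in auto)
      finally have "exp (\<kappa> * \<eta>) - 1 \<le> c" by (simp add: c_def algebra_simps)
      hence "p e * (exp (\<kappa> * \<eta>) - 1) \<le> p e * c" by (intro mult_left_mono pe)
      with True show ?thesis by (simp add: mult.commute)
    next
      case False
      have "card (\<phi> e \<inter> W) \<le> card (\<phi> e)" using fW by (intro card_mono) auto
      also have "\<dots> \<le> d" using insert.prems by auto
      finally have "exp (card (\<phi> e \<inter> W) + \<kappa> * \<eta>) \<le> \<kappa>" using \<kappa> by simp
      hence "exp (card (\<phi> e \<inter> W) + \<kappa> * \<eta>) - 1 \<le> \<kappa> + c" using c0 by simp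
      hence "p e * (exp (card (\<phi> e \<inter> W) + \<kappa> * \<eta>) - 1) \<le> p e * (\<kappa> + c)" by (intro mult_left_mono pe)
      with False show ?thesis by (simp add: algebra_simps)
    qed
  qed auto
  also have "\<dots> = exp (\<kappa> * I (insert e F) W + c * (\<Sum>e\<in>insert e F. p e))"
  proof -
    have "I (insert e F) W = (if \<phi> e \<inter> W \<noteq> {} then p e else 0) + I F W"
    proof (cases "\<phi> e \<inter> W \<noteq> {}")
      case True
      hence "{e'. e' \<in> insert e F \<and> \<phi> e' \<inter> W \<noteq> {}} = insert e {e'. e' \<in> F \<and> \<phi> e' \<inter> W \<noteq> {}}" by auto
      with True insert.hyps show ?thesis by (simp add: I_def)
    next
      case False
      hence "{e'. e' \<in> insert e F \<and> \<phi> e' \<inter> W \<noteq> {}} = {e'. e' \<in> F \<and> \<phi> e' \<inter> W \<noteq> {}}" by auto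
      with False show ?thesis by (simp add: I_def)
    qed
    with insert.hyps show ?thesis by (simp add: algebra_simps flip: exp_add)
  qed
  finally show ?case by (simp add: M_def I_def c_def)
qed

text \<open>Starting from \<open>W = {}\<close> removes the intensity term, and only the
  compensation remains. Up to the factor \<open>2 * \<kappa>\<close> it is
  \<open>\<eta> * (\<Sum>e\<in>F. p e)\<close>, a bound for the expected number of ordered colliding
  pairs.\<close>

lemma excess_tail:
  fixes p :: "'e \<Rightarrow> real" and \<phi> :: "'e \<Rightarrow> 'v set"
  assumes fin: "finite F" and p: "\<And>e. e \<in> F \<Longrightarrow> 0 \<le> p e" "\<And>e. e \<in> F \<Longrightarrow> p e \<le> 1"
    and \<phi>: "\<And>e. e \<in> F \<Longrightarrow> finite (\<phi> e)" "\<And>e. e \<in> F \<Longrightarrow> card (\<phi> e) \<le> d"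
    and \<eta>: "\<And>e. e \<in> F \<Longrightarrow> (\<Sum>f | f \<in> F \<and> \<phi> f \<inter> \<phi> e \<noteq> {}. p f) \<le> \<eta>" "\<eta> \<ge> 0"
    and \<kappa>: "\<kappa> = exp (real d + 1)" "\<kappa> * \<eta> \<le> 1"
  shows "measure_pmf.prob (Pi_pmf F False (\<lambda>e. bernoulli_pmf (p e)))
            {\<omega>. excess \<phi> {} {e\<in>F. \<omega> e} \<ge> x} \<le> exp (2 * \<kappa> * \<eta> * (\<Sum>e\<in>F. p e) - x)"
proof -
  have "measure_pmf.prob (Pi_pmf F False (\<lambda>e. bernoulli_pmf (p e))) {\<omega>. excess \<phi> {} {e\<in>F. \<omega> e} \<ge> x}
     \<le> measure_pmf.expectation (Pi_pmf F False (\<lambda>e. bernoulli_pmf (p e))) (\<lambda>\<omega>. exp (excess \<phi> {} {e\<in>F. \<omega> e})) * exp (- x)"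
    by (rule pmf_markov) (auto intro!: finite_set_Pi_pmf fin)
  also have "\<dots> \<le> exp (2 * \<kappa> * \<eta> * (\<Sum>e\<in>F. p e)) * exp (- x)"
    using excess_mgf[OF assms, of "{}"] by (intro mult_right_mono) auto
  finally show ?thesis by (simp flip: exp_add)
qed

lemma card_subsets_containing:
  assumes "finite X" "Y \<subseteq> X" "card Y \<le> k"
  shows "card {e. e \<subseteq> X \<and> card e = k \<and> Y \<subseteq> e} = (card X - card Y) choose (k - card Y)"
proof -
  have fY: "finite Y" using assms by (blast intro: finite_subset)
  have "bij_betw (\<lambda>e. e - Y) {e. e \<subseteq> X \<and> card e = k \<and> Y \<subseteq> e} {e. e \<subseteq> X - Y \<and> card e = k - card Y}"
  proof (rule bij_betwI[where g = "\<lambda>e. e \<union> Y"])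
    show "(\<lambda>e. e - Y) \<in> {e. e \<subseteq> X \<and> card e = k \<and> Y \<subseteq> e} \<rightarrow> {e. e \<subseteq> X - Y \<and> card e = k - card Y}"
      using fY by (auto simp: card_Diff_subset)
    show "(\<lambda>e. e \<union> Y) \<in> {e. e \<subseteq> X - Y \<and> card e = k - card Y} \<rightarrow> {e. e \<subseteq> X \<and> card e = k \<and> Y \<subseteq> e}"
    proof
      fix e assume e: "e \<in> {e. e \<subseteq> X - Y \<and> card e = k - card Y}"
      hence "finite e" using assms(1) finite_subset[of e X] by auto
      moreover have "e \<inter> Y = {}" using e by auto
      ultimately show "e \<union> Y \<in> {e. e \<subseteq> X \<and> card e = k \<and> Y \<subseteq> e}"
        using e assms fY by (auto simp: card_Un_disjoint)
    qed
  qed auto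
  hence "card {e. e \<subseteq> X \<and> card e = k \<and> Y \<subseteq> e} = card {e. e \<subseteq> X - Y \<and> card e = k - card Y}"
    by (rule bij_betw_same_card)
  also have "\<dots> = card (X - Y) choose (k - card Y)"
    using assms by (intro n_subsets) auto
  also have "card (X - Y) = card X - card Y" using fY assms by (simp add: card_Diff_subset)
  finally show ?thesis .
qed

section \<open>Mean offspring\<close>

text \<open>After cancellation of the factorials the ratio is a product of the quotients
  \<open>(m - i) / (n - i)\<close>, all in [0, 1]. A product of such numbers moves by at most the
  sum of the changes of its factors.\<close>

lemma binomial_ratio_approx:
  fixes \<theta> D :: real
  assumes "k \<le> m" "m \<le> n" "0 \<le> \<theta>" "\<theta> \<le> 1"
    and D: "\<And>i. i < k \<Longrightarrow> \<bar>real (m - i) / real (n - i) - \<theta>\<bar> \<le> D"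
  shows "\<bar>real (m choose k) / real (n choose k) - \<theta> ^ k\<bar> \<le> real k * D"
proof -
  have "real (m choose k) / real (n choose k)
      = (\<Prod>i=0..<k. real (m - i) / real (k - i)) / (\<Prod>i=0..<k. real (n - i) / real (k - i))"
    using assms by (simp add: binomial_altdef_of_nat)
  also have "\<dots> = (\<Prod>i=0..<k. real (m - i) / real (n - i))"
    unfolding prod_dividef[symmetric] by (intro prod.cong) auto
  finally have "\<bar>real (m choose k) / real (n choose k) - \<theta> ^ k\<bar>
     = norm ((\<Prod>i=0..<k. real (m - i) / real (n - i)) - (\<Prod>i=0..<k. \<theta>))"
    by simp
  also have "\<dots> \<le> (\<Sum>i=0..<k. norm (real (m - i) / real (n - i) - \<theta>))"
    by (rule norm_prod_diff) (use assms in \<open>auto simp: divide_le_eq_1\<close>)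
  also have "\<dots> \<le> (\<Sum>i=0..<k. D)" by (intro sum_mono) (use D in auto)
  finally show ?thesis by simp
qed

lemma sum_exists_le:
  fixes f :: "'a \<Rightarrow> real"
  assumes "finite E" "finite X" "\<And>e. e \<in> E \<Longrightarrow> f e \<ge> 0"
  shows "(\<Sum>e | e \<in> E \<and> (\<exists>x\<in>X. R x e). f e) \<le> (\<Sum>x\<in>X. \<Sum>e | e \<in> E \<and> R x e. f e)"
proof -
  have "(\<Sum>e | e \<in> E \<and> (\<exists>x\<in>X. R x e). f e) \<le> (\<Sum>e | e \<in> E \<and> (\<exists>x\<in>X. R x e). \<Sum>x | x \<in> X \<and> R x e. f e)"
  proof (intro sum_mono)
    fix e assume e: "e \<in> {e. e \<in> E \<and> (\<exists>x\<in>X. R x e)}"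
    then obtain x where "x \<in> X" "R x e" by auto
    then have "(\<Sum>x\<in>{x}. f e) \<le> (\<Sum>x | x \<in> X \<and> R x e. f e)"
      using e assms by (intro sum_mono2) auto
    then show "f e \<le> (\<Sum>x | x \<in> X \<and> R x e. f e)" by simp
  qed
  also have "\<dots> \<le> (\<Sum>e\<in>E. \<Sum>x | x \<in> X \<and> R x e. f e)"
    using assms by (intro sum_mono2) (auto intro!: sum_nonneg)
  also have "\<dots> = (\<Sum>x\<in>X. \<Sum>e | e \<in> E \<and> R x e. f e)"
    by (rule sum.swap_restrict) (use assms in auto)
  finally show ?thesis .
qed

text \<open>The spin vector is fixed here, so that only the edges are random. The lower bound on
  \<open>n\<close> leaves at least \<open>d\<close> vertices in each spin class when the total spin
  is at most \<open>s\<close>; \<open>s\<close> stays free until it is set to the order of the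
  typical fluctuations.\<close>

locale balanced_hsbm =
  fixes n d :: nat and a b s :: real and \<sigma> :: "nat \<Rightarrow> int"
  assumes d: "d \<ge> 3" and ab: "a \<ge> b" "b > 0"
    and n: "real n \<ge> s + 2 * real d" and s: "s \<ge> 0"
    and pn_le_1: "pn n d a \<le> 1"
    and spin: "\<And>i. i \<in> {1..n} \<Longrightarrow> \<sigma> i = 1 \<or> \<sigma> i = -1"
    and balanced: "\<bar>\<Sum>i\<in>{1..n}. real_of_int (\<sigma> i)\<bar> \<le> s"
begin

abbreviation "ds \<equiv> dsubsets n d"

definition P :: "nat set \<Rightarrow> real" where
  "P e = (if spins_agree \<sigma> e then pn n d a else pn n d b)"

abbreviation "M \<equiv> Pi_pmf ds False (\<lambda>e. bernoulli_pmf (P e))"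

text \<open>An idealised mean: vertices count once for every edge shared with \<open>v\<close>, and
  exposed vertices are ignored. Repetitions between edges are charged to \<open>excess\<close>, and
  edges that touch further parents or exposed vertices to \<open>mean_fresh\<close>. The weight will
  be 1 for sizes and the spin for spin sums.\<close>

definition mean_offspring :: "(nat \<Rightarrow> real) \<Rightarrow> nat \<Rightarrow> real" where
  "mean_offspring \<tau> v = (\<Sum>e | e \<in> ds \<and> v \<in> e. P e * (\<Sum>j\<in>e - {v}. \<tau> j))"

lemma n2d: "n \<ge> 2 * d"
proof -
  have "real n \<ge> real (2 * d)" using n s by simp
  then show ?thesis by (simp only: of_nat_le_iff)
qed

lemma npos: "n > 0" using n2d d by simp

lemma finite_ds [simp]: "finite ds"
  by (auto simp: dsubsets_def intro: finite_subset[of _ "Pow {1..n}"])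

lemma dsD: "e \<in> ds \<Longrightarrow> finite e" "e \<in> ds \<Longrightarrow> card e = d" "e \<in> ds \<Longrightarrow> e \<subseteq> {1..n}"
  by (auto simp: dsubsets_def intro: finite_subset[OF _ finite_atLeastAtMost])

lemma choose_pos: "real (n choose (d - 1)) > 0"
  using n2d d by simp

lemma pn_nonneg: "0 \<le> pn n d b" "pn n d b \<le> pn n d a"
  using ab choose_pos by (auto simp: pn_def divide_right_mono)

lemma P_bounds: "0 \<le> P e" "P e \<le> pn n d a" "P e \<le> 1"
  using pn_nonneg pn_le_1 by (auto simp: P_def)

lemma card_ds_vertex:
  assumes "v \<in> {1..n}"
  shows "card {e. e \<in> ds \<and> v \<in> e} = (n - 1) choose (d - 1)"
  using card_subsets_containing[of "{1..n}" "{v}" d] assms d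
  by (simp add: dsubsets_def conj_assoc)

lemma card_ds_pair:
  assumes "v \<in> {1..n}" "w \<in> {1..n}" "v \<noteq> w"
  shows "card {e. e \<in> ds \<and> v \<in> e \<and> w \<in> e} = (n - 2) choose (d - 2)"
proof -
  have "{e. e \<subseteq> {1..n} \<and> card e = d \<and> {v, w} \<subseteq> e} = {e. e \<in> ds \<and> v \<in> e \<and> w \<in> e}"
    by (auto simp: dsubsets_def)
  then show ?thesis
    using card_subsets_containing[of "{1..n}" "{v, w}" d] assms d by (simp add: numeral_2_eq_2)
qed

lemma choose_absorb: "real (d - 1) * real (n choose (d - 1)) = real n * real ((n - 1) choose (d - 2))"
proof -
  have "(d - 1) * (n choose (d - 1)) = n * ((n - 1) choose (d - 1 - 1))"
    using d by (intro times_binomial_minus1_eq) auto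
  then show ?thesis by (metis of_nat_mult diff_diff_left one_add_one)
qed

lemma choose_absorb':
  "real (d - 1) * real ((n - 1) choose (d - 1)) = (real n - 1) * real ((n - 2) choose (d - 2))"
proof -
  have "(d - 1) * ((n - 1) choose (d - 1)) = (n - 1) * ((n - 1 - 1) choose (d - 1 - 1))"
    using d by (intro times_binomial_minus1_eq) auto
  moreover have "n - 1 - 1 = n - 2" "d - 1 - 1 = d - 2" by auto
  ultimately have "real ((d - 1) * ((n - 1) choose (d - 1))) = real ((n - 1) * ((n - 2) choose (d - 2)))"
    by simp
  then show ?thesis using npos by (simp add: of_nat_diff)
qed

text \<open>By absorption the binomial is at most \<open>(d - 1) / n\<close> times
  \<open>n choose (d - 1)\<close>. Hence the edges through a fixed pair of vertices have total mass
  of order 1 / n.\<close>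

lemma pn_times_pairs: 
  assumes "x \<ge> 0" shows "pn n d x * real ((n - 2) choose (d - 2)) \<le> x * real d / real n"
proof -
  have "real ((n - 2) choose (d - 2)) \<le> real ((n - 1) choose (d - 2))"
    by (intro of_nat_mono binomial_right_mono) auto
  also have "\<dots> = real (d - 1) * real (n choose (d - 1)) / real n"
    using choose_absorb npos by simp
  also have "\<dots> \<le> real d * real (n choose (d - 1)) / real n"
    by (intro divide_right_mono mult_right_mono) auto
  finally have "pn n d x * real ((n - 2) choose (d - 2)) \<le> pn n d x * (real d * real (n choose (d - 1)) / real n)"
    using assms by (intro mult_left_mono) (auto simp: pn_def)
  then show ?thesis using choose_pos by (simp add: pn_def)
qed

lemma sum_P_vertex: "(\<Sum>e | e \<in> ds \<and> v \<in> e. P e) \<le> a"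
proof (cases "v \<in> {1..n}")
  case True
  have "(\<Sum>e | e \<in> ds \<and> v \<in> e. P e) \<le> (\<Sum>e | e \<in> ds \<and> v \<in> e. pn n d a)"
    by (intro sum_mono P_bounds)
  also have "\<dots> = real ((n - 1) choose (d - 1)) * pn n d a"
    using card_ds_vertex[OF True] by simp
  also have "\<dots> \<le> real (n choose (d - 1)) * pn n d a"
    using pn_nonneg by (intro mult_right_mono of_nat_mono binomial_right_mono) auto
  finally show ?thesis using choose_pos by (simp add: pn_def)
next
  case False
  then have eq: "{e. e \<in> ds \<and> v \<in> e} = {}" using dsD(3) by blast
  show ?thesis using ab by (simp only: eq) simp
qed

lemma sum_P_pair:
  assumes "v \<noteq> w"
  shows "(\<Sum>e | e \<in> ds \<and> v \<in> e \<and> w \<in> e. P e) \<le> a * real d / real n"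
proof (cases "v \<in> {1..n} \<and> w \<in> {1..n}")
  case True
  have "(\<Sum>e | e \<in> ds \<and> v \<in> e \<and> w \<in> e. P e) \<le> (\<Sum>e | e \<in> ds \<and> v \<in> e \<and> w \<in> e. pn n d a)"
    by (intro sum_mono P_bounds)
  also have "\<dots> = pn n d a * real ((n - 2) choose (d - 2))"
    using card_ds_pair[of v w] True assms by simp
  also have "\<dots> \<le> a * real d / real n" using ab by (intro pn_times_pairs) auto
  finally show ?thesis .
next
  case False
  then have eq: "{e. e \<in> ds \<and> v \<in> e \<and> w \<in> e} = {}" using dsD(3) by blast
  show ?thesis using ab by (simp only: eq) simp
qed

text \<open>A weight that is constant on spin classes sees only the all-agree edges beyond the
  background rate, which is why both the size and the spin sum of the offspring have
  means proportional to the weight of the parent.\<close>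

lemma mean_offspring_eq:
  assumes v: "v \<in> {1..n}" and \<tau>: "\<And>j. j \<in> {1..n} \<Longrightarrow> \<sigma> j = \<sigma> v \<Longrightarrow> \<tau> j = \<tau> v"
  defines "n\<^sub>v \<equiv> card {j \<in> {1..n}. \<sigma> j = \<sigma> v}"
  shows "mean_offspring \<tau> v = pn n d b * (real ((n - 2) choose (d - 2)) * (\<Sum>j\<in>{1..n} - {v}. \<tau> j))
     + (pn n d a - pn n d b) * (real (d - 1) * \<tau> v * real ((n\<^sub>v - 1) choose (d - 1)))"
proof -
  let ?E = "{e. e \<in> ds \<and> v \<in> e}"
  let ?E' = "{e. e \<in> ds \<and> v \<in> e \<and> spins_agree \<sigma> e}"
  let ?g = "\<lambda>e. \<Sum>j\<in>e - {v}. \<tau> j"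
  have fin: "finite ?E" by simp
  have "mean_offspring \<tau> v = (\<Sum>e\<in>?E. pn n d b * ?g e + (if spins_agree \<sigma> e then (pn n d a - pn n d b) * ?g e else 0))"
    unfolding mean_offspring_def by (intro sum.cong) (auto simp: P_def algebra_simps)
  also have "\<dots> = pn n d b * (\<Sum>e\<in>?E. ?g e) + (\<Sum>e\<in>?E. if spins_agree \<sigma> e then (pn n d a - pn n d b) * ?g e else 0)"
    by (simp only: sum.distrib sum_distrib_left[of "pn n d b"])
  also have "(\<Sum>e\<in>?E. if spins_agree \<sigma> e then (pn n d a - pn n d b) * ?g e else 0)
      = (\<Sum>e | e \<in> ?E \<and> spins_agree \<sigma> e. (pn n d a - pn n d b) * ?g e)"
    by (rule sum.inter_filter[OF fin, symmetric])
  also have "{e. e \<in> ?E \<and> spins_agree \<sigma> e} = ?E'" by auto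
  also have "(\<Sum>e\<in>?E'. (pn n d a - pn n d b) * ?g e) = (pn n d a - pn n d b) * (\<Sum>e\<in>?E'. ?g e)"
    by (simp add: sum_distrib_left)
  also have "(\<Sum>e\<in>?E. ?g e) = real ((n - 2) choose (d - 2)) * (\<Sum>j\<in>{1..n} - {v}. \<tau> j)"
  proof -
    have "(\<Sum>e\<in>?E. ?g e) = (\<Sum>e\<in>?E. \<Sum>j | j \<in> {1..n} - {v} \<and> j \<in> e. \<tau> j)"
    proof (intro sum.cong refl)
      fix e assume "e \<in> ?E"
      then have "e \<subseteq> {1..n}" using dsD(3)[of e] by simp
      then show "e - {v} = {j. j \<in> {1..n} - {v} \<and> j \<in> e}" by auto
    qed
    also have "\<dots> = (\<Sum>j\<in>{1..n} - {v}. \<Sum>e | e \<in> ?E \<and> j \<in> e. \<tau> j)"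
      by (rule sum.swap_restrict) auto
    also have "\<dots> = (\<Sum>j\<in>{1..n} - {v}. real ((n - 2) choose (d - 2)) * \<tau> j)"
    proof (intro sum.cong refl)
      fix j assume "j \<in> {1..n} - {v}"
      then show "(\<Sum>e | e \<in> ?E \<and> j \<in> e. \<tau> j) = real ((n - 2) choose (d - 2)) * \<tau> j"
        using card_ds_pair[of v j] v by (simp add: conj_assoc)
    qed
    finally show ?thesis by (simp add: sum_distrib_left)
  qed
  also have "(\<Sum>e\<in>?E'. ?g e) = (\<Sum>e\<in>?E'. real (d - 1) * \<tau> v)"
  proof (intro sum.cong refl)
    fix e assume e: "e \<in> ?E'"
    have "e \<subseteq> {1..n}" using e dsD(3)[of e] by simp
    moreover have "\<sigma> j = \<sigma> v" if "j \<in> e" for j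
      using e that unfolding spins_agree_def by blast
    ultimately have "?g e = (\<Sum>j\<in>e - {v}. \<tau> v)"
      by (intro sum.cong refl \<tau>) blast+
    then show "?g e = real (d - 1) * \<tau> v" using e dsD by (simp add: card_Diff_singleton)
  qed
  also have "\<dots> = real (d - 1) * \<tau> v * real (card ?E')" by simp
  also have "?E' = {e. e \<subseteq> {j \<in> {1..n}. \<sigma> j = \<sigma> v} \<and> card e = d \<and> {v} \<subseteq> e}"
  proof (intro set_eqI iffI)
    fix e assume e: "e \<in> {e. e \<subseteq> {j \<in> {1..n}. \<sigma> j = \<sigma> v} \<and> card e = d \<and> {v} \<subseteq> e}"
    then have eq: "\<sigma> j = \<sigma> v" if "j \<in> e" for j using that by auto
    have "spins_agree \<sigma> e" unfolding spins_agree_def by (metis eq)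
    with e show "e \<in> ?E'" by (auto simp: dsubsets_def)
  qed (unfold dsubsets_def spins_agree_def, blast)
  also have "card \<dots> = (n\<^sub>v - 1) choose (d - 1)"
    unfolding n\<^sub>v_def using d v by (subst card_subsets_containing) simp_all
  finally show ?thesis .
qed

text \<open>The product \<open>\<sigma> v * \<sigma> j\<close> is 1 on the class of \<open>v\<close>
  and -1 off it, so its sum over \<open>j\<close> is twice the class size minus \<open>n\<close>. Up
  to sign this sum is the total spin.\<close>

lemma spin_class_size:
  assumes v: "v \<in> {1..n}"
  defines "n\<^sub>v \<equiv> card {j \<in> {1..n}. \<sigma> j = \<sigma> v}"
  shows "\<bar>2 * real n\<^sub>v - real n\<bar> \<le> s" "n\<^sub>v \<ge> d" "n\<^sub>v \<le> n"
proof -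
  have "(\<Sum>j\<in>{1..n}. real_of_int (\<sigma> v * \<sigma> j)) = (\<Sum>j\<in>{1..n}. 2 * (if \<sigma> j = \<sigma> v then 1 else 0) - 1)"
    by (intro sum.cong refl) (use spin spin[OF v] in force)
  also have "\<dots> = 2 * (\<Sum>j\<in>{1..n}. if \<sigma> j = \<sigma> v then 1 else 0) - real n"
    by (simp add: sum_subtractf sum_distrib_left)
  also have "(\<Sum>j\<in>{1..n}. if \<sigma> j = \<sigma> v then 1 else 0) = real n\<^sub>v"
    unfolding n\<^sub>v_def by (subst sum.inter_filter[symmetric]) auto
  also have "(\<Sum>j\<in>{1..n}. real_of_int (\<sigma> v * \<sigma> j)) = \<sigma> v * (\<Sum>j\<in>{1..n}. real_of_int (\<sigma> j))"
    by (simp add: sum_distrib_left)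
  finally have "\<bar>2 * real n\<^sub>v - real n\<bar> = \<bar>\<Sum>j\<in>{1..n}. real_of_int (\<sigma> j)\<bar>"
    using spin[OF v] by auto
  then show 1: "\<bar>2 * real n\<^sub>v - real n\<bar> \<le> s" using balanced by simp
  then have "real n\<^sub>v \<ge> real d" using n by linarith
  then show "n\<^sub>v \<ge> d" by simp
  have "n\<^sub>v \<le> card {1..n}" unfolding n\<^sub>v_def by (intro card_mono) auto
  then show "n\<^sub>v \<le> n" by simp
qed

text \<open>The error per factor of a binomial ratio. In \<open>ratio_class\<close> the deviation
  from 1/2 has numerator \<open>2 * m - 2 - n - i\<close>, where \<open>2 * m - n\<close> is at most
  \<open>s\<close> in absolute value and \<open>i < d\<close>.\<close>

definition "\<delta> = (s + real d + 2) / real n"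

lemma \<delta>_nonneg: "\<delta> \<ge> 0" using s by (simp add: \<delta>_def)

lemma ratio_all: "\<bar>real ((n - 1) choose (d - 1)) / real (n choose (d - 1)) - 1\<bar> \<le> real d * \<delta>"
proof -
  have "\<bar>real ((n - 1) choose (d - 1)) / real (n choose (d - 1)) - 1 ^ (d - 1)\<bar> \<le> real (d - 1) * \<delta>"
  proof (rule binomial_ratio_approx)
    fix i assume i: "i < d - 1"
    have "real (n - i) \<ge> real n / 2" "real (n - i) > 0" "real (n - 1 - i) = real (n - i) - 1" using i n2d by auto
    then have "\<bar>real (n - 1 - i) / real (n - i) - 1\<bar> = 1 / real (n - i)" by (simp add: field_simps)
    also have "\<dots> \<le> 1 / (real n / 2)"
      using \<open>real (n - i) \<ge> real n / 2\<close> npos by (intro divide_left_mono mult_pos_pos) (auto intro: less_le_trans)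
    also have "\<dots> \<le> \<delta>" using s npos by (simp add: \<delta>_def field_simps)
    finally show "\<bar>real (n - 1 - i) / real (n - i) - 1\<bar> \<le> \<delta>" .
  qed (use n2d d in auto)
  also have "\<dots> \<le> real d * \<delta>" by (intro mult_right_mono \<delta>_nonneg) auto
  finally show ?thesis by simp
qed

lemma ratio_class:
  assumes v: "v \<in> {1..n}"
  shows "\<bar>real ((card {j \<in> {1..n}. \<sigma> j = \<sigma> v} - 1) choose (d - 1)) / real (n choose (d - 1)) - (1 / 2) ^ (d - 1)\<bar> \<le> real d * \<delta>"
proof -
  define m where "m = card {j \<in> {1..n}. \<sigma> j = \<sigma> v}"
  note m = spin_class_size[OF v, folded m_def]
  have "\<bar>real ((m - 1) choose (d - 1)) / real (n choose (d - 1)) - (1 / 2) ^ (d - 1)\<bar> \<le> real (d - 1) * \<delta>"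
  proof (rule binomial_ratio_approx)
    fix i assume i: "i < d - 1"
    have ni: "real (n - i) \<ge> real n / 2" "real (n - i) > 0" "real (n - i) = real n - real i" using i n2d by auto
    have mi: "real (m - 1 - i) = real m - 1 - real i" using i m by auto
    have "\<bar>real (m - 1 - i) / real (n - i) - 1 / 2\<bar> = \<bar>2 * real m - 2 - real n - real i\<bar> / (2 * real (n - i))"
      using ni unfolding mi by (simp add: field_simps)
    also have "\<dots> \<le> (s + real d + 2) / (2 * real (n - i))"
      using m(1) i ni by (intro divide_right_mono) auto
    also have "\<dots> \<le> (s + real d + 2) / real n"
      using ni npos s by (intro divide_left_mono) auto
    finally show "\<bar>real (m - 1 - i) / real (n - i) - 1 / 2\<bar> \<le> \<delta>" by (simp add: \<delta>_def)
  qed (use m d in auto)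
  also have "\<dots> \<le> real d * \<delta>" by (intro mult_right_mono \<delta>_nonneg) auto
  finally show ?thesis by (simp add: m_def)
qed

lemma mean_offspring_size:
  assumes v: "v \<in> {1..n}"
  shows "\<bar>mean_offspring (\<lambda>_. 1) v - alpha d a b\<bar> \<le> 2 * (real d)\<^sup>2 * a * \<delta>"
proof -
  let ?C = "real (n choose (d - 1))"
  let ?r1 = "real ((n - 1) choose (d - 1)) / ?C"
  let ?r2 = "real ((card {j \<in> {1..n}. \<sigma> j = \<sigma> v} - 1) choose (d - 1)) / ?C"
  have "(\<Sum>j\<in>{1..n} - {v}. 1::real) = real n - 1" using v by (simp add: of_nat_diff)
  then have "mean_offspring (\<lambda>_. 1) v = pn n d b * (real ((n - 2) choose (d - 2)) * (real n - 1))
     + (pn n d a - pn n d b) * (real (d - 1) * 1 * real ((card {j \<in> {1..n}. \<sigma> j = \<sigma> v} - 1) choose (d - 1)))"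
    using mean_offspring_eq[OF v, of "\<lambda>_. 1"] by simp
  also have "real ((n - 2) choose (d - 2)) * (real n - 1) = real (d - 1) * real ((n - 1) choose (d - 1))"
    using choose_absorb' by (simp add: mult.commute)
  finally have "mean_offspring (\<lambda>_. 1) v = real (d - 1) * (b * ?r1 + (a - b) * ?r2)"
    by (simp add: pn_def algebra_simps diff_divide_distrib)
  \<comment> \<open>The background rate \<open>b\<close> on all edges at \<open>v\<close>, plus the
    surplus \<open>a - b\<close> on the limiting fraction \<open>(1 / 2) ^ (d - 1)\<close> of them
    whose other vertices all agree with \<open>v\<close>.\<close>
  moreover have "alpha d a b = real (d - 1) * (b * 1 + (a - b) * (1 / 2) ^ (d - 1))"
    using d by (simp add: alpha_def field_simps of_nat_diff power_divide)
  ultimately have "mean_offspring (\<lambda>_. 1) v - alpha d a b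
      = real (d - 1) * (b * (?r1 - 1) + (a - b) * (?r2 - (1 / 2) ^ (d - 1)))"
    by (simp add: algebra_simps)
  also have "\<bar>\<dots>\<bar> \<le> real (d - 1) * (b * (real d * \<delta>) + (a - b) * (real d * \<delta>))"
    unfolding abs_mult using ab ratio_all ratio_class[OF v]
    by (intro mult_mono order_trans[OF abs_triangle_ineq] add_mono) (auto simp: abs_mult intro!: mult_left_mono)
  also have "\<dots> = real (d - 1) * (real d * (a * \<delta>))" by (simp add: algebra_simps)
  also have "\<dots> \<le> (2 * real d) * (real d * (a * \<delta>))"
    using ab \<delta>_nonneg by (intro mult_right_mono) auto
  finally show ?thesis by (simp add: power2_eq_square algebra_simps)
qed

text \<open>The background rate sees the spins only through their total, which without
  \<open>v\<close> is at most \<open>s + 1\<close> and enters with a factor of order 1 / n. What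
  remains is the surplus on all-agree edges, where the \<open>d - 1\<close> other vertices carry the
  spin of \<open>v\<close>.\<close>

lemma mean_offspring_spin:
  assumes v: "v \<in> {1..n}"
  shows "\<bar>mean_offspring (\<lambda>j. real_of_int (\<sigma> j)) v - beta d a b * real_of_int (\<sigma> v)\<bar> \<le> 2 * (real d)\<^sup>2 * a * \<delta>"
proof -
  let ?C = "real (n choose (d - 1))"
  let ?r2 = "real ((card {j \<in> {1..n}. \<sigma> j = \<sigma> v} - 1) choose (d - 1)) / ?C"
  let ?S = "\<Sum>j\<in>{1..n} - {v}. real_of_int (\<sigma> j)"
  let ?q = "pn n d b * real ((n - 2) choose (d - 2))"
  have sv: "\<bar>real_of_int (\<sigma> v)\<bar> = 1" using spin[OF v] by auto
  have S: "\<bar>?S\<bar> \<le> s + 1"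
  proof -
    have "?S = (\<Sum>j\<in>{1..n}. real_of_int (\<sigma> j)) - real_of_int (\<sigma> v)"
      using v by (simp add: sum_diff1)
    then show ?thesis using balanced sv by linarith
  qed
  have "mean_offspring (\<lambda>j. real_of_int (\<sigma> j)) v = ?q * ?S + real (d - 1) * \<sigma> v * ((a - b) * ?r2)"
    by (subst mean_offspring_eq[OF v]) (simp_all add: pn_def algebra_simps diff_divide_distrib)
  moreover have "beta d a b * \<sigma> v = real (d - 1) * \<sigma> v * ((a - b) * (1 / 2) ^ (d - 1))"
    using d by (simp add: beta_def field_simps of_nat_diff power_divide)
  ultimately have "mean_offspring (\<lambda>j. real_of_int (\<sigma> j)) v - beta d a b * \<sigma> v
      = ?q * ?S + real (d - 1) * \<sigma> v * ((a - b) * (?r2 - (1 / 2) ^ (d - 1)))"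
    by (simp add: algebra_simps)
  also have "\<bar>\<dots>\<bar> \<le> \<bar>?q * ?S\<bar> + \<bar>real (d - 1) * \<sigma> v * ((a - b) * (?r2 - (1 / 2) ^ (d - 1)))\<bar>"
    by (rule abs_triangle_ineq)
  also have "\<bar>real (d - 1) * \<sigma> v * ((a - b) * (?r2 - (1 / 2) ^ (d - 1)))\<bar>
      = real (d - 1) * ((a - b) * \<bar>?r2 - (1 / 2) ^ (d - 1)\<bar>)"
    using ab sv by (simp add: abs_mult)
  also have "\<dots> \<le> real d * (a * (real d * \<delta>))"
    using ab ratio_class[OF v] \<delta>_nonneg by (intro mult_mono) auto
  also have "\<bar>?q * ?S\<bar> \<le> (b * real d / real n) * (s + 1)"
    unfolding abs_mult[of ?q] using S pn_times_pairs[of b] ab pn_nonneg by (intro mult_mono) auto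
  also have "(b * real d / real n) * (s + 1) = real d * b * ((s + 1) / real n)" by simp
  also have "\<dots> \<le> real d * (real d * a) * \<delta>"
  proof (rule mult_mono)
    show "real d * b \<le> real d * (real d * a)"
      using ab d mult_mono[of 1 "real d" b a] by (intro mult_left_mono) auto
    show "(s + 1) / real n \<le> \<delta>" unfolding \<delta>_def by (intro divide_right_mono) auto
  qed (use ab s in auto)
  finally show ?thesis by (simp add: power2_eq_square algebra_simps)
qed

end

section \<open>Offspring of a sphere\<close>

text \<open>Edges that meet \<open>U\<close> count as exposed and are left out, so the result avoids
  \<open>U\<close> without subtracting it.\<close>

definition offspring :: "nat set \<Rightarrow> nat set \<Rightarrow> nat set set \<Rightarrow> nat set" where
  "offspring U A H = \<Union>{e \<in> H. e \<inter> U = {} \<and> e \<inter> A \<noteq> {}} - A"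

context balanced_hsbm
begin

definition fresh :: "nat set \<Rightarrow> nat set \<Rightarrow> nat set set" where
  "fresh U A = {e \<in> ds. e \<inter> U = {} \<and> e \<inter> A \<noteq> {}}"

lemma finite_fresh [simp]: "finite (fresh U A)"
  by (simp add: fresh_def)

lemma fresh_subset: "fresh U A \<subseteq> ds"
  by (auto simp: fresh_def)

lemma sum_P_fresh:
  assumes "finite A"
  shows "(\<Sum>e\<in>fresh U A. P e) \<le> a * real (card A)"
proof -
  have "(\<Sum>e\<in>fresh U A. P e) \<le> (\<Sum>e | e \<in> ds \<and> (\<exists>v\<in>A. v \<in> e). P e)"
    by (intro sum_mono2) (auto simp: fresh_def P_bounds)
  also have "\<dots> \<le> (\<Sum>v\<in>A. \<Sum>e | e \<in> ds \<and> v \<in> e. P e)"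
    by (intro sum_exists_le) (use assms in \<open>auto simp: P_bounds\<close>)
  also have "\<dots> \<le> (\<Sum>v\<in>A. a)" by (intro sum_mono sum_P_vertex)
  finally show ?thesis by (simp add: mult.commute)
qed

lemma sum_P_pairs:
  assumes "finite X" "\<And>x. x \<in> X \<Longrightarrow> fst x \<noteq> snd x"
  shows "(\<Sum>e | e \<in> ds \<and> (\<exists>x\<in>X. fst x \<in> e \<and> snd x \<in> e). P e) \<le> real (card X) * (a * real d / real n)"
proof -
  have "(\<Sum>e | e \<in> ds \<and> (\<exists>x\<in>X. fst x \<in> e \<and> snd x \<in> e). P e)
      \<le> (\<Sum>x\<in>X. \<Sum>e | e \<in> ds \<and> (fst x \<in> e \<and> snd x \<in> e). P e)"
    by (intro sum_exists_le) (use assms in \<open>auto simp: P_bounds\<close>)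
  also have "\<dots> \<le> (\<Sum>x\<in>X. a * real d / real n)"
    by (intro sum_mono sum_P_pair assms)
  finally show ?thesis by simp
qed

text \<open>A fresh edge that collides with \<open>e\<close> outside \<open>A\<close> contains a
  vertex of \<open>A\<close> and a vertex of \<open>e - A\<close>. There are at most
  \<open>card A * d\<close> such pairs, and the edges through each have total mass at most
  \<open>a * d / n\<close>.\<close>

lemma fresh_collision_rate:
  assumes "finite A" "e \<in> ds"
  shows "(\<Sum>f | f \<in> fresh U A \<and> (f - A) \<inter> (e - A) \<noteq> {}. P f) \<le> real (card A) * (real d)\<^sup>2 * a / real n"
proof -
  have fe: "finite e" using assms dsD by auto
  have "(\<Sum>f | f \<in> fresh U A \<and> (f - A) \<inter> (e - A) \<noteq> {}. P f)
     \<le> (\<Sum>f | f \<in> ds \<and> (\<exists>x\<in>A \<times> (e - A). fst x \<in> f \<and> snd x \<in> f). P f)"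
    by (intro sum_mono2) (auto simp: fresh_def P_bounds)
  also have "\<dots> \<le> real (card (A \<times> (e - A))) * (a * real d / real n)"
    by (intro sum_P_pairs) (use assms fe in auto)
  also have "\<dots> \<le> real (card A * d) * (a * real d / real n)"
  proof (intro mult_right_mono of_nat_mono)
    have "card (e - A) \<le> card e" using fe by (intro card_mono) auto
    then show "card (A \<times> (e - A)) \<le> card A * d"
      using assms dsD by (simp add: card_cartesian_product)
  qed (use ab in auto)
  finally show ?thesis by (simp add: power2_eq_square algebra_simps)
qed

text \<open>The two sums can differ only on edges that contain a vertex of \<open>A\<close> together
  with another vertex of \<open>A \<union> U\<close>: an edge with a single vertex in
  \<open>A\<close> and none in \<open>U\<close> contributes its other vertices to both. The
  exceptional edges are counted through such pairs, and each changes the sum by at most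
  \<open>2 * d ^ 2\<close>.\<close>

lemma mean_fresh:
  assumes fin: "finite A" "finite U" and disj: "U \<inter> A = {}" and \<tau>: "\<And>j. \<bar>\<tau> j\<bar> \<le> 1"
  shows "\<bar>(\<Sum>e\<in>fresh U A. P e * (\<Sum>j\<in>e - A. \<tau> j)) - (\<Sum>v\<in>A. mean_offspring \<tau> v)\<bar>
       \<le> 2 * real d ^ 3 * a * (real (card A + card U))\<^sup>2 / real n"
proof -
  let ?g = "\<lambda>A e. \<Sum>j\<in>e - A. \<tau> j"
  define h where "h = (\<lambda>e. (if e \<inter> U = {} \<and> e \<inter> A \<noteq> {} then ?g A e else 0) - (\<Sum>v | v \<in> A \<and> v \<in> e. ?g {v} e))"
  let ?X = "{x \<in> A \<times> (A \<union> U). fst x \<noteq> snd x}"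
  define C where "C = {e. e \<in> ds \<and> (\<exists>x\<in>?X. fst x \<in> e \<and> snd x \<in> e)}"
  have 1: "(\<Sum>e\<in>fresh U A. P e * ?g A e) = (\<Sum>e\<in>ds. P e * (if e \<inter> U = {} \<and> e \<inter> A \<noteq> {} then ?g A e else 0))"
    unfolding fresh_def by (subst sum.inter_filter) (auto intro!: sum.cong)
  have 2: "(\<Sum>v\<in>A. mean_offspring \<tau> v) = (\<Sum>e\<in>ds. P e * (\<Sum>v | v \<in> A \<and> v \<in> e. ?g {v} e))"
    unfolding mean_offspring_def sum_distrib_left[of "P _"]
    by (rule sum.swap_restrict[symmetric]) (use fin in auto)
  have gb: "\<bar>?g B e\<bar> \<le> real d" if "e \<in> ds" for B e
  proof -
    have "\<bar>?g B e\<bar> \<le> (\<Sum>j\<in>e - B. \<bar>\<tau> j\<bar>)" by (rule sum_abs)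
    also have "\<dots> \<le> (\<Sum>j\<in>e - B. 1)" by (intro sum_mono \<tau>)
    also have "\<dots> \<le> real (card e)" using dsD(1)[OF that] by (simp add: card_mono)
    finally show ?thesis using dsD(2)[OF that] by simp
  qed
  have hb: "\<bar>h e\<bar> \<le> 2 * (real d)\<^sup>2" if e: "e \<in> ds" for e
  proof -
    have "\<bar>\<Sum>v | v \<in> A \<and> v \<in> e. ?g {v} e\<bar> \<le> (\<Sum>v | v \<in> A \<and> v \<in> e. \<bar>?g {v} e\<bar>)" by (rule sum_abs)
    also have "\<dots> \<le> (\<Sum>v | v \<in> A \<and> v \<in> e. real d)" by (intro sum_mono gb e)
    also have "\<dots> \<le> real (card e) * real d"
      using dsD(1)[OF e] by (auto intro!: mult_right_mono card_mono)
    finally have "\<bar>\<Sum>v | v \<in> A \<and> v \<in> e. ?g {v} e\<bar> \<le> (real d)\<^sup>2"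
      using dsD(2)[OF e] by (simp add: power2_eq_square)
    moreover have "\<bar>if e \<inter> U = {} \<and> e \<inter> A \<noteq> {} then ?g A e else 0\<bar> \<le> (real d)\<^sup>2"
    proof -
      have "real d \<le> (real d)\<^sup>2" using d self_le_power[of "real d" 2] by simp
      with gb[OF e, of A] have "\<bar>?g A e\<bar> \<le> (real d)\<^sup>2" by (rule order_trans)
      then show ?thesis by simp
    qed
    ultimately show ?thesis unfolding h_def by linarith
  qed
  have h0: "h e = 0" if e: "e \<in> ds" "e \<notin> C" for e
  proof (cases "e \<inter> A = {}")
    case True
    then have eq: "{v. v \<in> A \<and> v \<in> e} = {}" by auto
    show ?thesis using True unfolding h_def by (simp only: eq) simp
  next
    case False
    then obtain v where v: "v \<in> e" "v \<in> A" by auto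
    have nx: "x \<notin> e" if "x \<in> A \<union> U" "x \<noteq> v" for x
    proof
      assume "x \<in> e"
      then have "(v, x) \<in> ?X" "fst (v, x) \<in> e \<and> snd (v, x) \<in> e" using v that by auto
      then have "e \<in> C" using e(1) unfolding C_def by blast
      with e(2) show False by (rule notE)
    qed
    have eqs: "{v. v \<in> A \<and> v \<in> e} = {v}" "e \<inter> U = {}" "e - A = e - {v}"
      using v nx disj by auto
    show ?thesis using False unfolding h_def by (simp only: eqs) simp
  qed
  have "(\<Sum>e\<in>fresh U A. P e * ?g A e) - (\<Sum>v\<in>A. mean_offspring \<tau> v) = (\<Sum>e\<in>ds. P e * h e)"
    unfolding 1 2 h_def by (simp only: sum_subtractf[symmetric] right_diff_distrib)
  also have "\<bar>\<dots>\<bar> \<le> (\<Sum>e\<in>ds. \<bar>P e * h e\<bar>)" by (rule sum_abs)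
  also have "\<dots> = (\<Sum>e\<in>C. \<bar>P e * h e\<bar>)"
  proof (intro sum.mono_neutral_right ballI)
    fix e assume "e \<in> ds - C"
    then have "h e = 0" by (intro h0) auto
    then show "\<bar>P e * h e\<bar> = 0" by (simp only: mult_zero_right abs_zero)
  qed (auto simp: C_def)
  also have "\<dots> \<le> (\<Sum>e\<in>C. P e * (2 * (real d)\<^sup>2))"
  proof (intro sum_mono)
    fix e assume "e \<in> C"
    then have "\<bar>h e\<bar> \<le> 2 * (real d)\<^sup>2" by (intro hb) (simp add: C_def)
    then have "P e * \<bar>h e\<bar> \<le> P e * (2 * (real d)\<^sup>2)" by (intro mult_left_mono P_bounds)
    then show "\<bar>P e * h e\<bar> \<le> P e * (2 * (real d)\<^sup>2)"
      by (simp only: abs_mult abs_of_nonneg[OF P_bounds(1)])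
  qed
  also have "\<dots> = (\<Sum>e\<in>C. P e) * (2 * (real d)\<^sup>2)" by (simp only: sum_distrib_right)
  also have "\<dots> \<le> (real (card ?X) * (a * real d / real n)) * (2 * (real d)\<^sup>2)"
    unfolding C_def by (intro mult_right_mono sum_P_pairs) (use fin in auto)
  also have "real (card ?X) \<le> (real (card A + card U))\<^sup>2"
  proof -
    have "card ?X \<le> card (A \<times> (A \<union> U))" using fin by (intro card_mono) auto
    also have "\<dots> = card A * card (A \<union> U)" by (simp add: card_cartesian_product)
    also have "\<dots> \<le> (card A + card U) * (card A + card U)"
      by (intro mult_mono card_Un_le) auto
    finally show ?thesis by (simp add: power2_eq_square flip: of_nat_mult of_nat_add del: of_nat_add of_nat_mult)
  qed
  then have "(real (card ?X) * (a * real d / real n)) * (2 * (real d)\<^sup>2)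
     \<le> ((real (card A + card U))\<^sup>2 * (a * real d / real n)) * (2 * (real d)\<^sup>2)"
    using ab by (intro mult_right_mono) auto
  finally have "\<bar>(\<Sum>e\<in>fresh U A. P e * ?g A e) - (\<Sum>v\<in>A. mean_offspring \<tau> v)\<bar>
    \<le> ((real (card A + card U))\<^sup>2 * (a * real d / real n)) * (2 * (real d)\<^sup>2)" .
  also have "(x * (a * real d / real n)) * (2 * (real d)\<^sup>2) = 2 * real d ^ 3 * a * x / real n" for x
    by (simp add: power2_eq_square power3_eq_cube)
  finally show ?thesis .
qed

lemma prob_restrict:
  assumes "F \<subseteq> ds"
  shows "measure_pmf.prob M {\<omega>. R {e \<in> F. \<omega> e}}
       = measure_pmf.prob (Pi_pmf F False (\<lambda>e. bernoulli_pmf (P e))) {\<omega>. R {e \<in> F. \<omega> e}}"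
proof -
  have "{e \<in> F. (if e \<in> F then \<omega> e else False)} = {e \<in> F. \<omega> e}" for \<omega> :: "nat set \<Rightarrow> bool" by auto
  then show ?thesis by (subst Pi_pmf_subset[OF finite_ds assms]) (simp add: vimage_def)
qed

text \<open>The exposed vertices are \<open>U\<close> and the current sphere is \<open>A\<close>. The offspring weight differs
  from a sum of independent terms by at most the number of collisions.\<close>

lemma offspring_concentration:
  assumes A: "A \<subseteq> {1..n}" and U: "finite U" "U \<inter> A = {}"
    and \<tau>: "\<And>j. \<bar>\<tau> j\<bar> \<le> 1"
    and mean: "\<And>v. v \<in> A \<Longrightarrow> \<bar>mean_offspring \<tau> v - \<rho> * \<tau> v\<bar> \<le> 2 * (real d)\<^sup>2 * a * \<delta>"
    and B: "real (card A + card U) \<le> B" "B\<^sup>2 \<le> real n" "B * (s + real d + 2) \<le> real n"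
      "exp (real d + 1) * a * (real d)\<^sup>2 * B \<le> real n"
    and L: "0 < L" "L \<le> m" "real (card A) \<le> m"
  shows "measure_pmf.prob M {\<omega>. \<not> \<bar>(\<Sum>j\<in>offspring U A {e\<in>ds. \<omega> e}. \<tau> j) - \<rho> * (\<Sum>v\<in>A. \<tau> v)\<bar>
            \<le> 4 * real d ^ 3 * a + (3 + (a + 3) * real d) * sqrt (L * m)}
       \<le> (2 + exp (2 * exp (real d + 1) * (real d)\<^sup>2 * a\<^sup>2)) * exp (- 3 * L)"
proof -
  define F where "F = fresh U A"
  define \<phi> where "\<phi> = (\<lambda>e. e - A)"
  define w where "w = (\<lambda>e. \<Sum>j\<in>e - A. \<tau> j)"
  define \<mu> where "\<mu> = (\<Sum>e\<in>F. P e * w e)"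
  \<comment> \<open>The Chernoff scale. It makes each \<open>\<theta> * w e\<close> at most
    \<open>sqrt (L / m) <= 1\<close> in absolute value and the summed second moments at most
    \<open>a * L\<close>. The threshold \<open>(a + 3) * L\<close> then leaves
    \<open>exp (- 3 * L)\<close>, and division by \<open>\<theta>\<close> turns it into the
    deviation \<open>(a + 3) * d * sqrt (L * m)\<close>.\<close>
  define \<theta> where "\<theta> = sqrt (L / m) / real d"
  define \<kappa> where "\<kappa> = exp (real d + 1)"
  define \<eta> where "\<eta> = real (card A) * (real d)\<^sup>2 * a / real n"
  let ?MF = "Pi_pmf F False (\<lambda>e. bernoulli_pmf (P e))"
  let ?bad = "\<lambda>H. \<not> \<bar>(\<Sum>j\<in>\<Union>(\<phi> ` H). \<tau> j) - \<rho> * (\<Sum>v\<in>A. \<tau> v)\<bar>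
            \<le> 4 * real d ^ 3 * a + (3 + (a + 3) * real d) * sqrt (L * m)"
  have fA: "finite A" using A finite_subset by blast
  have F: "F \<subseteq> ds" "finite F" by (auto simp: F_def fresh_subset)
  have a0: "a > 0" using ab by simp
  have d0: "real d > 0" using d by simp
  have m0: "m > 0" using L by simp
  have n0: "real n > 0" using npos by simp
  have B0: "B \<ge> 0" using B(1) by linarith
  have cA: "real (card A) \<le> B" using B(1) by simp
  have sumP: "(\<Sum>e\<in>F. P e) \<le> a * real (card A)" unfolding F_def by (rule sum_P_fresh[OF fA])
  have w: "\<bar>w e\<bar> \<le> real d" if "e \<in> F" for e
  proof -
    have e: "e \<in> ds" using that F by auto
    have "\<bar>w e\<bar> \<le> (\<Sum>j\<in>e - A. \<bar>\<tau> j\<bar>)" unfolding w_def by (rule sum_abs)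
    also have "\<dots> \<le> (\<Sum>j\<in>e - A. 1)" by (intro sum_mono \<tau>)
    also have "\<dots> \<le> real (card e)" using dsD(1)[OF e] by (simp add: card_mono)
    finally show ?thesis using dsD(2)[OF e] by simp
  qed
  have offspring: "offspring U A {e\<in>ds. \<omega> e} = \<Union>(\<phi> ` {e\<in>F. \<omega> e})" for \<omega>
    by (auto simp: offspring_def F_def fresh_def \<phi>_def)

  \<comment> \<open>Half of the constant is the error of \<open>mean_fresh\<close>; the other half
    covers the bias \<open>2 * d ^ 2 * a * \<delta>\<close> summed over \<open>A\<close>, where
    \<open>card A * \<delta> <= 1\<close>.\<close>
  have mean_total: "\<bar>\<mu> - \<rho> * (\<Sum>v\<in>A. \<tau> v)\<bar> \<le> 4 * real d ^ 3 * a"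
  proof -
    have "\<bar>\<mu> - (\<Sum>v\<in>A. mean_offspring \<tau> v)\<bar> \<le> 2 * real d ^ 3 * a * (real (card A + card U))\<^sup>2 / real n"
      unfolding \<mu>_def F_def w_def by (intro mean_fresh fA U \<tau>)
    also have "\<dots> = 2 * real d ^ 3 * a * ((real (card A + card U))\<^sup>2 / real n)" by simp
    also have "\<dots> \<le> 2 * real d ^ 3 * a * 1"
    proof (intro mult_left_mono)
      have "(real (card A + card U))\<^sup>2 \<le> B\<^sup>2" using B(1) by (intro power_mono) auto
      also have "\<dots> \<le> real n" by (rule B)
      finally show "(real (card A + card U))\<^sup>2 / real n \<le> 1" using n0 by simp
    qed (use a0 in auto)
    finally have 1: "\<bar>\<mu> - (\<Sum>v\<in>A. mean_offspring \<tau> v)\<bar> \<le> 2 * real d ^ 3 * a" by simp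
    have "\<bar>(\<Sum>v\<in>A. mean_offspring \<tau> v) - \<rho> * (\<Sum>v\<in>A. \<tau> v)\<bar> = \<bar>\<Sum>v\<in>A. mean_offspring \<tau> v - \<rho> * \<tau> v\<bar>"
      by (simp add: sum_subtractf sum_distrib_left)
    also have "\<dots> \<le> (\<Sum>v\<in>A. \<bar>mean_offspring \<tau> v - \<rho> * \<tau> v\<bar>)" by (rule sum_abs)
    also have "\<dots> \<le> (\<Sum>v\<in>A. 2 * (real d)\<^sup>2 * a * \<delta>)" by (intro sum_mono mean)
    also have "\<dots> = 2 * (real d)\<^sup>2 * a * (real (card A) * \<delta>)" by simp
    also have "\<dots> \<le> 2 * (real d)\<^sup>2 * a * 1"
    proof (intro mult_left_mono)
      have "real (card A) * (s + real d + 2) \<le> B * (s + real d + 2)"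
        using s by (intro mult_right_mono cA) auto
      also have "\<dots> \<le> real n" by (rule B)
      finally show "real (card A) * \<delta> \<le> 1" using n0 by (simp add: \<delta>_def)
    qed (use a0 in auto)
    also have "\<dots> \<le> 2 * real d ^ 3 * a"
      using a0 d power_increasing[of 2 3 "real d"] by simp
    finally show ?thesis using 1 by linarith
  qed

  have exc: "measure_pmf.prob ?MF {\<omega>. excess \<phi> {} {e\<in>F. \<omega> e} \<ge> 3 * L}
      \<le> exp (2 * exp (real d + 1) * (real d)\<^sup>2 * a\<^sup>2) * exp (- 3 * L)"
  proof -
    have \<eta>0: "\<eta> \<ge> 0" using a0 by (simp add: \<eta>_def)
    have \<kappa>0: "\<kappa> > 0" by (simp add: \<kappa>_def)
    have \<eta>1: "\<kappa> * \<eta> \<le> 1"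
    proof -
      have "exp (real d + 1) * a * (real d)\<^sup>2 * real (card A) \<le> exp (real d + 1) * a * (real d)\<^sup>2 * B"
        using a0 by (intro mult_left_mono cA) auto
      also have "\<dots> \<le> real n" by (rule B)
      finally show ?thesis using n0 by (simp add: \<kappa>_def \<eta>_def algebra_simps)
    qed
    have "measure_pmf.prob ?MF {\<omega>. excess \<phi> {} {e\<in>F. \<omega> e} \<ge> 3 * L} \<le> exp (2 * \<kappa> * \<eta> * (\<Sum>e\<in>F. P e) - 3 * L)"
    proof (rule excess_tail[OF F(2) _ _ _ _ _ \<eta>0 \<kappa>_def \<eta>1])
      fix e assume e: "e \<in> F"
      then have e': "e \<in> ds" using F by auto
      show "finite (\<phi> e)" using dsD(1)[OF e'] by (simp add: \<phi>_def)
      have "card (\<phi> e) \<le> card e" unfolding \<phi>_def using dsD(1)[OF e'] by (intro card_mono) auto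
      then show "card (\<phi> e) \<le> d" using dsD(2)[OF e'] by simp
      show "(\<Sum>f | f \<in> F \<and> \<phi> f \<inter> \<phi> e \<noteq> {}. P f) \<le> \<eta>"
        unfolding F_def \<phi>_def \<eta>_def by (rule fresh_collision_rate[OF fA e'])
    qed (auto simp: P_bounds)
    \<comment> \<open>The collision rate and the expected number of fresh edges each bring a factor
      \<open>card A\<close>, so their product is at most a constant times
      \<open>B\<^sup>2 / n\<close>. Collisions thus cost only a constant factor in the tail.\<close>
    moreover have "\<kappa> * \<eta> * (\<Sum>e\<in>F. P e) \<le> \<kappa> * (real d)\<^sup>2 * a\<^sup>2"
    proof -
      have "\<kappa> * \<eta> * (\<Sum>e\<in>F. P e) \<le> \<kappa> * \<eta> * (a * real (card A))"
        using \<kappa>0 \<eta>0 by (intro mult_left_mono sumP) auto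
      also have "\<dots> = \<kappa> * (real d)\<^sup>2 * a\<^sup>2 * ((real (card A))\<^sup>2 / real n)"
        by (simp add: \<eta>_def power2_eq_square)
      also have "\<dots> \<le> \<kappa> * (real d)\<^sup>2 * a\<^sup>2 * 1"
      proof (intro mult_left_mono)
        have "(real (card A))\<^sup>2 \<le> B\<^sup>2" using cA by (intro power_mono) auto
        also have "\<dots> \<le> real n" by (rule B)
        finally show "(real (card A))\<^sup>2 / real n \<le> 1" using n0 by simp
      qed (use \<kappa>0 in auto)
      finally show ?thesis by simp
    qed
    then have "exp (2 * \<kappa> * \<eta> * (\<Sum>e\<in>F. P e) - 3 * L) \<le> exp (2 * \<kappa> * (real d)\<^sup>2 * a\<^sup>2 + - 3 * L)" by simp
    ultimately show ?thesis unfolding \<kappa>_def exp_add by linarith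
  qed

  have dev: "measure_pmf.prob ?MF {\<omega>. \<bar>(\<Sum>e\<in>{e\<in>F. \<omega> e}. w e) - \<mu>\<bar> \<ge> (a + 3) * real d * sqrt (L * m)}
      \<le> 2 * exp (- 3 * L)"
  proof -
    define g where "g = (\<lambda>e x. if x then \<theta> * w e else 0)"
    have \<theta>0: "\<theta> > 0" using L m0 d0 by (simp add: \<theta>_def)
    have Eg: "measure_pmf.expectation (bernoulli_pmf (P e)) (g e) = \<theta> * (P e * w e)"
      and Eg2: "measure_pmf.expectation (bernoulli_pmf (P e)) (\<lambda>x. (g e x)\<^sup>2) = (\<theta> * w e)\<^sup>2 * P e" for e
      by (simp_all add: g_def P_bounds)
    have lw: "\<bar>\<theta> * w e\<bar> \<le> sqrt (L / m)" if "e \<in> F" for e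
    proof -
      have "\<bar>\<theta> * w e\<bar> = \<theta> * \<bar>w e\<bar>" using \<theta>0 by (simp add: abs_mult)
      also have "\<dots> \<le> \<theta> * real d" using w[OF that] \<theta>0 by (intro mult_left_mono) auto
      also have "\<dots> = sqrt (L / m)" using d0 by (simp add: \<theta>_def)
      finally show ?thesis .
    qed
    have sq1: "sqrt (L / m) \<le> 1" using L m0 by simp
    have "measure_pmf.prob ?MF {\<omega>. \<bar>(\<Sum>e\<in>F. g e (\<omega> e)) - (\<Sum>e\<in>F. measure_pmf.expectation (bernoulli_pmf (P e)) (g e))\<bar> \<ge> (a + 3) * L}
      \<le> 2 * exp ((\<Sum>e\<in>F. measure_pmf.expectation (bernoulli_pmf (P e)) (\<lambda>x. (g e x)\<^sup>2)) - (a + 3) * L)"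
    proof (rule Pi_pmf_chernoff_abs[OF F(2)])
      fix e x assume "e \<in> F"
      from lw[OF this] sq1 have "\<bar>\<theta> * w e\<bar> \<le> 1" by linarith
      then show "\<bar>g e x\<bar> \<le> 1" by (simp add: g_def)
    qed auto
    also have "(\<Sum>e\<in>F. measure_pmf.expectation (bernoulli_pmf (P e)) (\<lambda>x. (g e x)\<^sup>2)) \<le> a * L"
    proof -
      have "(\<Sum>e\<in>F. (\<theta> * w e)\<^sup>2 * P e) \<le> (\<Sum>e\<in>F. (L / m) * P e)"
      proof (intro sum_mono mult_right_mono P_bounds)
        fix e assume "e \<in> F"
        have "(\<theta> * w e)\<^sup>2 = \<bar>\<theta> * w e\<bar>\<^sup>2" by simp
        also have "\<dots> \<le> (sqrt (L / m))\<^sup>2" by (intro power_mono lw \<open>e \<in> F\<close>) auto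
        also have "\<dots> = L / m" using L m0 by simp
        finally show "(\<theta> * w e)\<^sup>2 \<le> L / m" .
      qed
      also have "\<dots> = (L / m) * (\<Sum>e\<in>F. P e)" by (simp add: sum_distrib_left)
      also have "\<dots> \<le> (L / m) * (a * m)"
        using sumP L m0 a0 by (intro mult_left_mono) (auto intro: order_trans mult_left_mono)
      also have "\<dots> = a * L" using m0 by simp
      finally show ?thesis by (simp only: Eg2)
    qed
    also have "exp (a * L - (a + 3) * L) = exp (- 3 * L)" by (simp add: algebra_simps)
    finally have *: "measure_pmf.prob ?MF {\<omega>. \<bar>(\<Sum>e\<in>F. g e (\<omega> e)) - (\<Sum>e\<in>F. measure_pmf.expectation (bernoulli_pmf (P e)) (g e))\<bar> \<ge> (a + 3) * L}
       \<le> 2 * exp (- 3 * L)" by simp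
    have g: "(\<Sum>e\<in>F. g e (\<omega> e)) = \<theta> * (\<Sum>e\<in>{e\<in>F. \<omega> e}. w e)" for \<omega>
      unfolding g_def sum_distrib_left by (rule sum.inter_filter[OF F(2), symmetric])
    have Egs: "(\<Sum>e\<in>F. measure_pmf.expectation (bernoulli_pmf (P e)) (g e)) = \<theta> * \<mu>"
      by (simp only: Eg \<mu>_def sum_distrib_left)
    have lam: "\<theta> * ((a + 3) * real d * sqrt (L * m)) = (a + 3) * L"
    proof -
      have "sqrt (L / m) * sqrt (L * m) = L" using L m0 by (simp flip: real_sqrt_mult)
      then show ?thesis using d0 by (simp add: \<theta>_def)
    qed
    have "(\<bar>\<theta> * x - \<theta> * \<mu>\<bar> \<ge> (a + 3) * L) = (\<bar>x - \<mu>\<bar> \<ge> (a + 3) * real d * sqrt (L * m))" for x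
    proof -
      have "\<bar>\<theta> * x - \<theta> * \<mu>\<bar> = \<theta> * \<bar>x - \<mu>\<bar>" using \<theta>0 by (simp add: abs_mult flip: right_diff_distrib)
      then show ?thesis unfolding lam[symmetric] using \<theta>0 by (simp add: mult_le_cancel_left_pos)
    qed
    with * show ?thesis by (simp only: g Egs)
  qed

  \<comment> \<open>Lets the collision allowance \<open>3 * L\<close> be absorbed in the order of
    the fluctuations; this is the summand 3 in the coefficient of
    \<open>sqrt (L * m)\<close>.\<close>
  have sqL: "L \<le> sqrt (L * m)"
    using L by (intro real_le_rsqrt) (simp add: power2_eq_square)
  have bad: "?bad {e\<in>F. \<omega> e} \<Longrightarrow> excess \<phi> {} {e\<in>F. \<omega> e} \<ge> 3 * L \<or>
      \<bar>(\<Sum>e\<in>{e\<in>F. \<omega> e}. w e) - \<mu>\<bar> \<ge> (a + 3) * real d * sqrt (L * m)" for \<omega>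
  proof (rule ccontr)
    assume b: "?bad {e\<in>F. \<omega> e}"
      and "\<not> (excess \<phi> {} {e\<in>F. \<omega> e} \<ge> 3 * L \<or> \<bar>(\<Sum>e\<in>{e\<in>F. \<omega> e}. w e) - \<mu>\<bar> \<ge> (a + 3) * real d * sqrt (L * m))"
    then have nb: "excess \<phi> {} {e\<in>F. \<omega> e} < 3 * L"
        "\<bar>(\<Sum>e\<in>{e\<in>F. \<omega> e}. w e) - \<mu>\<bar> < (a + 3) * real d * sqrt (L * m)" by auto
    have "\<bar>(\<Sum>j\<in>\<Union>(\<phi> ` {e\<in>F. \<omega> e}). \<tau> j) - (\<Sum>e\<in>{e\<in>F. \<omega> e}. \<Sum>j\<in>\<phi> e. \<tau> j)\<bar> \<le> excess \<phi> {} {e\<in>F. \<omega> e}"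
    proof (rule sum_Union_excess)
      fix e assume "e \<in> {e\<in>F. \<omega> e}"
      then show "finite (\<phi> e)" using F dsD(1) by (auto simp: \<phi>_def)
    qed (use F \<tau> in auto)
    then have "\<bar>(\<Sum>j\<in>\<Union>(\<phi> ` {e\<in>F. \<omega> e}). \<tau> j) - (\<Sum>e\<in>{e\<in>F. \<omega> e}. w e)\<bar> < 3 * L"
      using nb(1) by (simp add: w_def \<phi>_def)
    with nb(2) mean_total sqL
    have "\<bar>(\<Sum>j\<in>\<Union>(\<phi> ` {e\<in>F. \<omega> e}). \<tau> j) - \<rho> * (\<Sum>v\<in>A. \<tau> v)\<bar>
       \<le> 4 * real d ^ 3 * a + (3 * sqrt (L * m) + (a + 3) * real d * sqrt (L * m))" by linarith
    with b show False by (simp add: algebra_simps)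
  qed
  have "measure_pmf.prob M {\<omega>. ?bad {e\<in>F. \<omega> e}} = measure_pmf.prob ?MF {\<omega>. ?bad {e\<in>F. \<omega> e}}"
    by (rule prob_restrict[OF F(1)])
  also have "\<dots> \<le> measure_pmf.prob ?MF ({\<omega>. excess \<phi> {} {e\<in>F. \<omega> e} \<ge> 3 * L} \<union>
       {\<omega>. \<bar>(\<Sum>e\<in>{e\<in>F. \<omega> e}. w e) - \<mu>\<bar> \<ge> (a + 3) * real d * sqrt (L * m)})"
  proof (intro measure_pmf.finite_measure_mono subsetI)
    fix \<omega> assume "\<omega> \<in> {\<omega>. ?bad {e\<in>F. \<omega> e}}"
    then show "\<omega> \<in> {\<omega>. excess \<phi> {} {e\<in>F. \<omega> e} \<ge> 3 * L} \<union>
       {\<omega>. \<bar>(\<Sum>e\<in>{e\<in>F. \<omega> e}. w e) - \<mu>\<bar> \<ge> (a + 3) * real d * sqrt (L * m)}"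
      using bad[of \<omega>] by simp
  qed simp
  also have "\<dots> \<le> measure_pmf.prob ?MF {\<omega>. excess \<phi> {} {e\<in>F. \<omega> e} \<ge> 3 * L} +
       measure_pmf.prob ?MF {\<omega>. \<bar>(\<Sum>e\<in>{e\<in>F. \<omega> e}. w e) - \<mu>\<bar> \<ge> (a + 3) * real d * sqrt (L * m)}"
    by (rule measure_Un_le) auto
  also have "\<dots> \<le> exp (2 * exp (real d + 1) * (real d)\<^sup>2 * a\<^sup>2) * exp (- 3 * L) + 2 * exp (- 3 * L)"
    by (intro add_mono exc dev)
  finally show ?thesis unfolding offspring by (simp add: algebra_simps)
qed

end

section \<open>Exposing the spheres\<close>

lemma walk_exists_0 [simp]: "walk_exists H i j 0 \<longleftrightarrow> j = i"
  by (auto simp: walk_exists_def intro: exI[of _ "\<lambda>_. i"])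

lemma walk_exists_Suc:
  "walk_exists H i j (Suc t) \<longleftrightarrow> (\<exists>k. walk_exists H i k t \<and> k \<noteq> j \<and> (\<exists>e\<in>H. {k, j} \<subseteq> e))"
proof
  assume "walk_exists H i j (Suc t)"
  then obtain x where x: "x 0 = i" "x (Suc t) = j"
    "\<And>k. k < Suc t \<Longrightarrow> x k \<noteq> x (Suc k) \<and> (\<exists>e\<in>H. {x k, x (Suc k)} \<subseteq> e)"
    unfolding walk_exists_def by metis
  then have "walk_exists H i (x t) t" unfolding walk_exists_def by (intro exI[of _ x]) simp
  with x(2) x(3)[of t] show "\<exists>k. walk_exists H i k t \<and> k \<noteq> j \<and> (\<exists>e\<in>H. {k, j} \<subseteq> e)"
    by auto
next
  assume "\<exists>k. walk_exists H i k t \<and> k \<noteq> j \<and> (\<exists>e\<in>H. {k, j} \<subseteq> e)"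
  then obtain k x where k: "k \<noteq> j" "\<exists>e\<in>H. {k, j} \<subseteq> e" "x 0 = i" "x t = k"
    "\<forall>k<t. x k \<noteq> x (Suc k) \<and> (\<exists>e\<in>H. {x k, x (Suc k)} \<subseteq> e)"
    unfolding walk_exists_def by metis
  define y where "y = x(Suc t := j)"
  have "y 0 = i" "y (Suc t) = j" using k by (auto simp: y_def)
  moreover have "y r \<noteq> y (Suc r) \<and> (\<exists>e\<in>H. {y r, y (Suc r)} \<subseteq> e)" if "r < Suc t" for r
    using that k by (cases "r = t") (simp_all add: y_def)
  ultimately show "walk_exists H i j (Suc t)" unfolding walk_exists_def by blast
qed

lemma Vt_0 [simp]: "Vt H i 0 = {i}"
  by (auto simp: Vt_def)

lemma Vt_imp_walk: "j \<in> Vt H i t \<Longrightarrow> walk_exists H i j t"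
  by (simp add: Vt_def)

lemma walk_imp_Vt:
  assumes "walk_exists H i j t"
  shows "\<exists>s\<le>t. j \<in> Vt H i s"
proof -
  let ?s = "LEAST s. walk_exists H i j s"
  have "walk_exists H i j ?s" "?s \<le> t" using assms by (auto intro: LeastI Least_le)
  moreover have "\<not> walk_exists H i j s" if "s < ?s" for s using that by (rule not_less_Least)
  ultimately show ?thesis by (auto simp: Vt_def)
qed

lemma Vt_disjoint: "j \<in> Vt H i s \<Longrightarrow> j \<in> Vt H i t \<Longrightarrow> s = t"
  by (metis (mono_tags, lifting) Vt_def mem_Collect_eq nat_neq_iff)

lemma Vt_neighbour:
  assumes "k \<in> Vt H i s" "e \<in> H" "k \<in> e" "j \<in> e"
  shows "\<exists>r\<le>Suc s. j \<in> Vt H i r"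
proof (cases "k = j")
  case True
  then show ?thesis using assms by (intro exI[of _ s]) auto
next
  case False
  then have "walk_exists H i j (Suc s)" 
    using assms Vt_imp_walk[of k H i s] by (auto simp: walk_exists_Suc)
  then show ?thesis by (rule walk_imp_Vt)
qed

text \<open>The last vertex but one of a shortest walk lies at distance exactly \<open>t\<close>: if
  it were nearer, \<open>Vt_neighbour\<close> would place \<open>j\<close> within distance
  \<open>t\<close>.\<close>

lemma Vt_Suc_iff:
  "j \<in> Vt H i (Suc t) \<longleftrightarrow> (\<forall>s\<le>t. j \<notin> Vt H i s) \<and> (\<exists>k\<in>Vt H i t. \<exists>e\<in>H. {k, j} \<subseteq> e)"
proof (intro iffI conjI)
  assume j: "j \<in> Vt H i (Suc t)"
  then show far: "\<forall>s\<le>t. j \<notin> Vt H i s" by (metis Vt_disjoint Suc_n_not_le_n)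
  from j obtain k e where k: "walk_exists H i k t" "e \<in> H" "{k, j} \<subseteq> e"
    using Vt_imp_walk[OF j] by (auto simp: walk_exists_Suc)
  from walk_imp_Vt[OF k(1)] obtain s where s: "s \<le> t" "k \<in> Vt H i s" by auto
  have "s = t"
  proof (rule ccontr)
    assume "s \<noteq> t"
    with s have "Suc s \<le> t" by simp
    moreover from Vt_neighbour[OF s(2) k(2)] k(3) obtain r where "r \<le> Suc s" "j \<in> Vt H i r" by auto
    ultimately show False using far by (meson le_trans)
  qed
  with s k show "\<exists>k\<in>Vt H i t. \<exists>e\<in>H. {k, j} \<subseteq> e" by auto
next
  assume *: "(\<forall>s\<le>t. j \<notin> Vt H i s) \<and> (\<exists>k\<in>Vt H i t. \<exists>e\<in>H. {k, j} \<subseteq> e)"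
  then obtain k e where "k \<in> Vt H i t" "e \<in> H" "k \<in> e" "j \<in> e" by auto
  from Vt_neighbour[OF this] * show "j \<in> Vt H i (Suc t)" by (metis le_SucE)
qed

text \<open>An edge with a vertex nearer than \<open>t\<close> has all its vertices within distance
  \<open>t\<close>, so it cannot lead to the next sphere. The new sphere therefore uses no exposed
  edge.\<close>

lemma Vt_Suc_offspring:
  "Vt H i (Suc t) = offspring (\<Union>s<t. Vt H i s) (Vt H i t) H"
proof (intro set_eqI iffI)
  fix j assume "j \<in> Vt H i (Suc t)"
  then obtain k e where k: "\<forall>s\<le>t. j \<notin> Vt H i s" "k \<in> Vt H i t" "e \<in> H" "k \<in> e" "j \<in> e"
    by (auto simp: Vt_Suc_iff)
  have "e \<inter> (\<Union>s<t. Vt H i s) = {}"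
  proof (rule ccontr)
    assume "e \<inter> (\<Union>s<t. Vt H i s) \<noteq> {}"
    then obtain u s where u: "u \<in> e" "s < t" "u \<in> Vt H i s" by auto
    from Vt_neighbour[OF u(3) k(3) u(1) k(5)] obtain r where "r \<le> Suc s" "j \<in> Vt H i r" by auto
    with k(1) u(2) show False by (meson Suc_leI le_trans)
  qed
  with k show "j \<in> offspring (\<Union>s<t. Vt H i s) (Vt H i t) H"
    by (auto simp: offspring_def)
next
  fix j assume "j \<in> offspring (\<Union>s<t. Vt H i s) (Vt H i t) H"
  then obtain e k where e: "e \<in> H" "e \<inter> (\<Union>s<t. Vt H i s) = {}" "k \<in> e" "k \<in> Vt H i t"
    "j \<in> e" "j \<notin> Vt H i t"
    by (auto simp: offspring_def)
  have "j \<notin> Vt H i s" if "s \<le> t" for s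
  proof (cases "s = t")
    case False
    with that have "s < t" by simp
    with e(2,5) show ?thesis by blast
  qed (use e in simp)
  with e show "j \<in> Vt H i (Suc t)" by (auto simp: Vt_Suc_iff)
qed

text \<open>Supplies the stopping-set hypothesis of \<open>Pi_pmf_adapted\<close>. Agreement is
  demanded on the ball of \<open>H\<close> alone; the induction identifies the spheres of
  \<open>H'\<close> with those of \<open>H\<close> before they are used.\<close>

lemma Vt_local:
  assumes "\<And>e. e \<inter> (\<Union>s<t. Vt H i s) \<noteq> {} \<Longrightarrow> e \<in> H \<longleftrightarrow> e \<in> H'"
  shows "s \<le> t \<Longrightarrow> Vt H' i s = Vt H i s"
proof (induction s rule: less_induct)
  case (less s)
  show ?case
  proof (cases s)
    case 0
    then show ?thesis by simp
  next
    case (Suc r)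
    have eq: "Vt H' i q = Vt H i q" if "q \<le> r" for q
      using less that Suc by auto
    have "(\<exists>e\<in>H. {k, j} \<subseteq> e) = (\<exists>e\<in>H'. {k, j} \<subseteq> e)" if "k \<in> Vt H i r" for k j
    proof -
      have "e \<in> H \<longleftrightarrow> e \<in> H'" if "k \<in> e" for e
      proof (rule assms)
        have "r < t" using less.prems Suc by simp
        with \<open>k \<in> Vt H i r\<close> that show "e \<inter> (\<Union>s<t. Vt H i s) \<noteq> {}" by blast
      qed
      then show ?thesis by auto
    qed
    then show ?thesis unfolding Suc using eq by (auto simp: Vt_Suc_iff)
  qed
qed

lemma Vt_subset:
  assumes "i \<in> {1..n}" "H \<subseteq> dsubsets n d"
  shows "Vt H i t \<subseteq> {1..n}"
proof (cases t)
  case (Suc r)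
  show ?thesis
  proof
    fix j assume "j \<in> Vt H i t"
    then obtain e where "e \<in> H" "j \<in> e" unfolding Suc Vt_Suc_iff by auto
    moreover from this have "e \<subseteq> {1..n}" using assms(2) unfolding dsubsets_def by blast
    ultimately show "j \<in> {1..n}" by blast
  qed
qed (use assms in auto)

text \<open>An implication, so that its failure at given \<open>i\<close> and \<open>t\<close> can
  be bounded without knowing that the ball (\<open>B\<close>) and the sphere (\<open>m\<close>) are
  small. The premises are discharged afterwards and deterministically, in
  \<open>growth_ok_imp\<close>.\<close>

definition growth_ok ::
    "real \<Rightarrow> real \<Rightarrow> real \<Rightarrow> real \<Rightarrow> real \<Rightarrow> (nat \<Rightarrow> int) \<Rightarrow> nat set set \<Rightarrow> nat \<Rightarrow> nat \<Rightarrow> bool" where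
  "growth_ok \<alpha> \<beta> B m \<epsilon> \<sigma> H i t \<longleftrightarrow>
     ((\<Sum>r\<le>t. real (St H i r)) \<le> B \<and> real (St H i t) \<le> m \<longrightarrow>
      \<bar>real (St H i (Suc t)) - \<alpha> * real (St H i t)\<bar> \<le> \<epsilon> \<and>
      \<bar>real_of_int (Dt \<sigma> H i (Suc t)) - \<beta> * real_of_int (Dt \<sigma> H i t)\<bar> \<le> \<epsilon>)"

context balanced_hsbm
begin

lemma mean_offspring_cong:
  assumes "\<And>j. j \<in> {1..n} \<Longrightarrow> \<tau> j = \<tau>' j"
  shows "mean_offspring \<tau> v = mean_offspring \<tau>' v"
  unfolding mean_offspring_def
proof (intro sum.cong refl arg_cong2[where f = "(*)"])
  fix e j assume "e \<in> {e. e \<in> ds \<and> v \<in> e}" "j \<in> e - {v}"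
  then have "j \<in> {1..n}" using dsD(3)[of e] by blast
  then show "\<tau> j = \<tau>' j" by (rule assms)
qed

lemma sphere_step:
  fixes B L m :: real
  assumes i: "i \<in> {1..n}"
    and B: "B\<^sup>2 \<le> real n" "B * (s + real d + 2) \<le> real n"
      "exp (real d + 1) * a * (real d)\<^sup>2 * B \<le> real n"
    and L: "0 < L" "L \<le> m"
  defines "\<epsilon> \<equiv> 4 * real d ^ 3 * a + (3 + (a + 3) * real d) * sqrt (L * m)"
  shows "measure_pmf.prob M {\<omega>. \<not> growth_ok (alpha d a b) (beta d a b) B m \<epsilon> \<sigma> {e\<in>ds. \<omega> e} i t}
    \<le> 2 * (2 + exp (2 * exp (real d + 1) * (real d)\<^sup>2 * a\<^sup>2)) * exp (- 3 * L)"
proof -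
  define K where "K = 2 + exp (2 * exp (real d + 1) * (real d)\<^sup>2 * a\<^sup>2)"
  define H where "H = (\<lambda>\<omega>. {e\<in>ds. \<omega> e})"
  define T where "T = (\<lambda>\<omega>. (\<Union>r<t. Vt (H \<omega>) i r, Vt (H \<omega>) i t))"
  \<comment> \<open>\<open>\<sigma>\<close> is controlled on \<open>{1..n}\<close> only, whereas
    \<open>offspring_concentration\<close> asks for a weight bounded everywhere.\<close>
  define \<tau> where "\<tau> = (\<lambda>j. if j \<in> {1..n} then real_of_int (\<sigma> j) else 0)"
  define bad where "bad = (\<lambda>\<tau> \<rho> U A \<omega>. \<not> \<bar>(\<Sum>j\<in>offspring U A (H \<omega>). \<tau> j) - \<rho> * (\<Sum>v\<in>A. \<tau> v)\<bar> \<le> \<epsilon>)"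
  \<comment> \<open>Since \<open>Bad\<close> is false for inadmissible \<open>u\<close>, one bound
    holds for every value of the exposed data, as \<open>Pi_pmf_adapted\<close> requires.\<close>
  define G where "G = (\<lambda>u. case u of (U, A) \<Rightarrow> A \<subseteq> {1..n} \<and> finite U \<and> U \<inter> A = {} \<and>
      real (card A + card U) \<le> B \<and> real (card A) \<le> m)"
  define Bad where "Bad = (\<lambda>u \<omega>. G u \<and> (bad (\<lambda>_. 1) (alpha d a b) (fst u) (snd u) \<omega> \<or>
      bad \<tau> (beta d a b) (fst u) (snd u) \<omega>))"
  have Hds: "H \<omega> \<subseteq> ds" for \<omega> by (auto simp: H_def)
  have Vsub: "Vt (H \<omega>) i r \<subseteq> {1..n}" for \<omega> r by (rule Vt_subset[OF i Hds])
  have finV: "finite (Vt (H \<omega>) i r)" for \<omega> r using Vsub by (rule finite_subset) simp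
  have D: "(\<Sum>j\<in>Vt (H \<omega>) i r. \<tau> j) = real_of_int (Dt \<sigma> (H \<omega>) i r)" for \<omega> r
    unfolding Dt_def of_int_sum using Vsub[of \<omega> r] by (intro sum.cong) (auto simp: \<tau>_def)

  have "measure_pmf.prob M {\<omega>. Bad (T \<omega>) \<omega>} \<le> 2 * K * exp (- 3 * L)"
  proof (rule Pi_pmf_adapted[where S = "\<lambda>u. {e\<in>ds. e \<inter> fst u \<noteq> {}}"])
    fix f g :: "nat set \<Rightarrow> bool" assume fg: "\<And>e. e \<in> {e\<in>ds. e \<inter> fst (T f) \<noteq> {}} \<Longrightarrow> f e = g e"
    have "Vt (H g) i r = Vt (H f) i r" if "r \<le> t" for r
    proof (rule Vt_local[OF _ that])
      fix e assume "e \<inter> (\<Union>s<t. Vt (H f) i s) \<noteq> {}"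
      then show "(e \<in> H f) = (e \<in> H g)" using fg[of e] by (auto simp: T_def H_def)
    qed
    then show "T g = T f" by (auto simp: T_def)
  next
    fix u :: "nat set \<times> nat set" and f g :: "nat set \<Rightarrow> bool"
    assume fg: "\<And>e. e \<in> ds - {e\<in>ds. e \<inter> fst u \<noteq> {}} \<Longrightarrow> f e = g e"
    have "{e \<in> H f. e \<inter> fst u = {} \<and> e \<inter> snd u \<noteq> {}} = {e \<in> H g. e \<inter> fst u = {} \<and> e \<inter> snd u \<noteq> {}}"
      using fg by (auto simp: H_def)
    then have "offspring (fst u) (snd u) (H f) = offspring (fst u) (snd u) (H g)"
      unfolding offspring_def by (rule arg_cong)
    then show "Bad u f = Bad u g" by (simp add: Bad_def bad_def)
  next
    fix u :: "nat set \<times> nat set"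
    obtain U A where u: "u = (U, A)" by (cases u)
    show "measure_pmf.prob M {\<omega>. Bad u \<omega>} \<le> 2 * K * exp (- 3 * L)"
    proof (cases "G u")
      case False
      then show ?thesis by (simp add: Bad_def K_def add_nonneg_nonneg)
    next
      case True
      then have G: "A \<subseteq> {1..n}" "finite U" "U \<inter> A = {}" "real (card A + card U) \<le> B" "real (card A) \<le> m"
        by (auto simp: G_def u)
      have 1: "measure_pmf.prob M {\<omega>. bad (\<lambda>_. 1) (alpha d a b) U A \<omega>} \<le> K * exp (- 3 * L)"
        unfolding bad_def H_def \<epsilon>_def K_def
        by (rule offspring_concentration[OF G(1-3) _ _ G(4) B L G(5)])
           (use G(1) mean_offspring_size in auto)
      have 2: "measure_pmf.prob M {\<omega>. bad \<tau> (beta d a b) U A \<omega>} \<le> K * exp (- 3 * L)"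
        unfolding bad_def H_def \<epsilon>_def K_def
      proof (rule offspring_concentration[OF G(1-3) _ _ G(4) B L G(5)])
        show "\<bar>\<tau> j\<bar> \<le> 1" for j using spin[of j] by (auto simp: \<tau>_def)
        fix v assume "v \<in> A"
        then have v: "v \<in> {1..n}" using G by auto
        have "mean_offspring \<tau> v = mean_offspring (\<lambda>j. real_of_int (\<sigma> j)) v"
          by (rule mean_offspring_cong) (simp add: \<tau>_def)
        then show "\<bar>mean_offspring \<tau> v - beta d a b * \<tau> v\<bar> \<le> 2 * (real d)\<^sup>2 * a * \<delta>"
          using mean_offspring_spin[OF v] v by (simp add: \<tau>_def)
      qed
      have "measure_pmf.prob M {\<omega>. Bad u \<omega>} \<le> measure_pmf.prob M
          ({\<omega>. bad (\<lambda>_. 1) (alpha d a b) U A \<omega>} \<union> {\<omega>. bad \<tau> (beta d a b) U A \<omega>})"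
        by (intro measure_pmf.finite_measure_mono) (auto simp: Bad_def u)
      also have "\<dots> \<le> measure_pmf.prob M {\<omega>. bad (\<lambda>_. 1) (alpha d a b) U A \<omega>}
          + measure_pmf.prob M {\<omega>. bad \<tau> (beta d a b) U A \<omega>}"
        by (rule measure_Un_le) auto
      finally show ?thesis using 1 2 by simp
    qed
  qed auto
  moreover have "measure_pmf.prob M {\<omega>. \<not> growth_ok (alpha d a b) (beta d a b) B m \<epsilon> \<sigma> (H \<omega>) i t}
     \<le> measure_pmf.prob M {\<omega>. Bad (T \<omega>) \<omega>}"
  proof (intro measure_pmf.finite_measure_mono subsetI, unfold mem_Collect_eq)
    fix \<omega>
    assume "\<not> growth_ok (alpha d a b) (beta d a b) B m \<epsilon> \<sigma> (H \<omega>) i t"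
    then have *: "(\<Sum>r\<le>t. real (St (H \<omega>) i r)) \<le> B \<and> real (St (H \<omega>) i t) \<le> m \<and>
     \<not> (\<bar>real (St (H \<omega>) i (Suc t)) - alpha d a b * real (St (H \<omega>) i t)\<bar> \<le> \<epsilon> \<and>
        \<bar>real_of_int (Dt \<sigma> (H \<omega>) i (Suc t)) - beta d a b * real_of_int (Dt \<sigma> (H \<omega>) i t)\<bar> \<le> \<epsilon>)"
      unfolding growth_ok_def by blast
    have "card (\<Union>r<t. Vt (H \<omega>) i r) \<le> (\<Sum>r<t. St (H \<omega>) i r)"
      unfolding St_def by (rule card_UN_le) simp
    then have "real (card (\<Union>r<t. Vt (H \<omega>) i r)) \<le> (\<Sum>r<t. real (St (H \<omega>) i r))"
      by (simp flip: of_nat_sum)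
    also have "(\<Sum>r\<le>t. real (St (H \<omega>) i r)) = (\<Sum>r<t. real (St (H \<omega>) i r)) + real (St (H \<omega>) i t)"
      by (simp flip: lessThan_Suc_atMost)
    then have "(\<Sum>r<t. real (St (H \<omega>) i r)) = (\<Sum>r\<le>t. real (St (H \<omega>) i r)) - real (St (H \<omega>) i t)"
      by simp
    finally have "real (card (Vt (H \<omega>) i t) + card (\<Union>r<t. Vt (H \<omega>) i r)) \<le> B"
      using * by (simp add: St_def)
    moreover have "(\<Union>r<t. Vt (H \<omega>) i r) \<inter> Vt (H \<omega>) i t = {}"
      using Vt_disjoint[of _ "H \<omega>" i _ t] by blast
    ultimately have "G (T \<omega>)"
      using * Vsub[of \<omega> t] finV[of \<omega>] by (simp add: G_def T_def St_def)
    moreover have "bad (\<lambda>_. 1) (alpha d a b) (fst (T \<omega>)) (snd (T \<omega>)) \<omega> \<or> bad \<tau> (beta d a b) (fst (T \<omega>)) (snd (T \<omega>)) \<omega>"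
      using * unfolding T_def bad_def fst_conv snd_conv Vt_Suc_offspring[symmetric] D
      by (auto simp: St_def)
    ultimately show "Bad (T \<omega>) \<omega>" by (simp add: Bad_def)
  qed simp
  ultimately show ?thesis unfolding H_def K_def by (rule order_trans[rotated])
qed

end

section \<open>Accumulation of the errors\<close>

text \<open>The right-hand side is the exact solution of
  \<open>e (Suc t) = \<gamma> * e t + E * r ^ t\<close> with \<open>e u = 0\<close>, so the
  induction closes without loss.\<close>

lemma perturbed_geometric:
  fixes z :: "nat \<Rightarrow> real"
  assumes "r < \<gamma>" "u \<le> v"
    and step: "\<And>t. u \<le> t \<Longrightarrow> t < v \<Longrightarrow> \<bar>z (Suc t) - \<gamma> * z t\<bar> \<le> E * r ^ t"
    and "0 \<le> r"
  shows "\<bar>z v - \<gamma> ^ (v - u) * z u\<bar> \<le> E / (\<gamma> - r) * (\<gamma> ^ (v - u) * r ^ u - r ^ v)"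
proof -
  define c where "c = E / (\<gamma> - r)"
  have E: "E = c * (\<gamma> - r)" using assms(1) by (simp add: c_def)
  show ?thesis unfolding c_def[symmetric]
    using assms(2) step
  proof (induction v rule: dec_induct)
    case base
    then show ?case by simp
  next
    case (step v)
    have IH: "\<bar>z v - \<gamma> ^ (v - u) * z u\<bar> \<le> c * (\<gamma> ^ (v - u) * r ^ u - r ^ v)"
      using step by simp
    have S: "Suc v - u = Suc (v - u)" using step.hyps by simp
    have "z (Suc v) - \<gamma> ^ (Suc v - u) * z u = (z (Suc v) - \<gamma> * z v) + \<gamma> * (z v - \<gamma> ^ (v - u) * z u)"
      unfolding S by (simp add: algebra_simps)
    also have "\<bar>\<dots>\<bar> \<le> \<bar>z (Suc v) - \<gamma> * z v\<bar> + \<bar>\<gamma> * (z v - \<gamma> ^ (v - u) * z u)\<bar>"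
      by (rule abs_triangle_ineq)
    also have "\<dots> \<le> E * r ^ v + \<gamma> * (c * (\<gamma> ^ (v - u) * r ^ u - r ^ v))"
      unfolding abs_mult using step.prems step.hyps IH assms(1,4) by (intro add_mono mult_mono) auto
    also have "\<dots> = c * (\<gamma> ^ (Suc v - u) * r ^ u - r ^ Suc v)"
      unfolding S E by (simp add: algebra_simps)
    finally show ?case .
  qed
qed

text \<open>The first bound runs the recursion from 0 to \<open>t\<close>. The second runs it from
  \<open>t\<close> to \<open>l\<close> and divides by \<open>\<gamma> ^ (l - t)\<close>, which
  brings the accumulated error back to the order \<open>r ^ t\<close> of the error at its
  start.\<close>

lemma perturbed_geometric_bounds:
  fixes z :: "nat \<Rightarrow> real"
  assumes "0 \<le> r" "r < \<gamma>" "0 \<le> E" "t \<le> l"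
    and step: "\<And>t. t < l \<Longrightarrow> \<bar>z (Suc t) - \<gamma> * z t\<bar> \<le> E * r ^ t"
  shows "\<bar>z t\<bar> \<le> (\<bar>z 0\<bar> + E / (\<gamma> - r)) * \<gamma> ^ t"
    and "\<bar>z t - \<gamma> powr (real t - real l) * z l\<bar> \<le> E / (\<gamma> - r) * r ^ t"
proof -
  let ?c = "E / (\<gamma> - r)"
  have c: "?c \<ge> 0" and \<gamma>: "\<gamma> > 0" using assms by auto
  have "\<bar>z t - \<gamma> ^ t * z 0\<bar> \<le> ?c * (\<gamma> ^ t - r ^ t)"
    using perturbed_geometric[of r \<gamma> 0 t z E] assms by simp
  also have "\<dots> \<le> ?c * \<gamma> ^ t" using c assms by (intro mult_left_mono) auto
  finally have "\<bar>z t\<bar> \<le> \<bar>\<gamma> ^ t * z 0\<bar> + ?c * \<gamma> ^ t" by linarith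
  also have "\<bar>\<gamma> ^ t * z 0\<bar> = \<gamma> ^ t * \<bar>z 0\<bar>" using \<gamma> by (simp add: abs_mult)
  finally show "\<bar>z t\<bar> \<le> (\<bar>z 0\<bar> + ?c) * \<gamma> ^ t" by (simp add: algebra_simps)
  have "\<bar>z l - \<gamma> ^ (l - t) * z t\<bar> \<le> ?c * (\<gamma> ^ (l - t) * r ^ t - r ^ l)"
    using assms by (intro perturbed_geometric) auto
  also have "\<dots> \<le> ?c * (\<gamma> ^ (l - t) * r ^ t)" using c assms by (intro mult_left_mono) auto
  finally have *: "\<bar>z l - \<gamma> ^ (l - t) * z t\<bar> \<le> \<gamma> ^ (l - t) * (?c * r ^ t)" by (simp add: algebra_simps)
  have pw: "\<gamma> powr (real t - real l) = inverse (\<gamma> ^ (l - t))"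
  proof -
    have "real t - real l = - real (l - t)" using assms by simp
    then show ?thesis using \<gamma> by (simp only: powr_minus powr_realpow)
  qed
  have "\<gamma> ^ (l - t) * \<bar>z t - \<gamma> powr (real t - real l) * z l\<bar> = \<bar>\<gamma> ^ (l - t) * (z t - \<gamma> powr (real t - real l) * z l)\<bar>"
    using \<gamma> by (simp add: abs_mult)
  also have "\<dots> = \<bar>z l - \<gamma> ^ (l - t) * z t\<bar>"
    unfolding pw using \<gamma> by (simp add: right_diff_distrib abs_minus_commute flip: mult.assoc)
  also note *
  finally show "\<bar>z t - \<gamma> powr (real t - real l) * z l\<bar> \<le> ?c * r ^ t"
    using \<gamma> by (simp only: mult_le_cancel_left_pos zero_less_power)
qed

text \<open>Chosen as a square \<open>q * q\<close> to solve the bootstrap inequality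
  \<open>1 + (K1 + K2 * sqrt Q) / (\<alpha> - sqrt \<alpha>) <= Q\<close>: as
  \<open>sqrt Q = q >= 1\<close>, the left side is at most \<open>1 + (q - 1) * q\<close>, which is
  at most \<open>q * q\<close>.\<close>

definition growth_const :: "real \<Rightarrow> real \<Rightarrow> real \<Rightarrow> real" where
  "growth_const \<alpha> K1 K2 = (1 + (K1 + K2) / (\<alpha> - sqrt \<alpha>))\<^sup>2"

lemma sqrt_less_self: "1 < x \<Longrightarrow> sqrt x < x" for x :: real
  by (intro real_less_lsqrt) (auto simp: power2_eq_square)

lemma growth_const_bound:
  assumes "\<alpha> > 1" "K1 \<ge> 0" "K2 \<ge> 0"
  defines "Q \<equiv> growth_const \<alpha> K1 K2"
  shows "1 \<le> Q" "1 + (K1 + K2 * sqrt Q) / (\<alpha> - sqrt \<alpha>) \<le> Q"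
proof -
  let ?q = "1 + (K1 + K2) / (\<alpha> - sqrt \<alpha>)"
  have g: "\<alpha> - sqrt \<alpha> > 0" using sqrt_less_self assms by simp
  have q: "?q \<ge> 1" using g assms by simp
  have Q: "Q = ?q * ?q" by (simp add: Q_def growth_const_def power2_eq_square)
  have sq: "sqrt Q = ?q" using q by (simp add: Q)
  show "1 \<le> Q" unfolding Q using mult_mono[of 1 ?q 1 ?q] q by simp
  have "K1 * 1 \<le> K1 * ?q" using q assms by (intro mult_left_mono) auto
  then have "(K1 + K2 * sqrt Q) / (\<alpha> - sqrt \<alpha>) \<le> (K1 * ?q + K2 * ?q) / (\<alpha> - sqrt \<alpha>)"
    unfolding sq using g by (intro divide_right_mono) auto
  also have "\<dots> = ((K1 + K2) * ?q) / (\<alpha> - sqrt \<alpha>)" by (simp only: distrib_right)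
  also have "\<dots> = (?q - 1) * ?q" by simp
  also have "\<dots> = Q - ?q" by (simp only: Q left_diff_distrib mult_1)
  finally show "1 + (K1 + K2 * sqrt Q) / (\<alpha> - sqrt \<alpha>) \<le> Q"
    using q by linarith
qed

text \<open>The bootstrap. One-step bounds below \<open>u\<close> give the sphere bounds up to
  \<open>u\<close>, and a geometric sum gives the ball bound. These are the premises of
  \<open>growth_ok\<close> at \<open>u\<close>, which returns the one-step bound there. By
  \<open>growth_const_bound\<close> the same \<open>Q\<close> comes out as went in.\<close>

lemma growth_ok_imp:
  fixes \<alpha> \<beta> K1 K2 L B :: real
  assumes \<alpha>: "\<alpha> > 1" and \<beta>: "\<beta> > 0" "\<beta>\<^sup>2 > \<alpha>" and L: "L \<ge> 1" and K: "K1 \<ge> 0" "K2 \<ge> 0"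
    and Q: "Q = growth_const \<alpha> K1 K2" and B: "Q * L * \<alpha> ^ l / (\<alpha> - 1) \<le> B"
    and \<sigma>: "\<bar>\<sigma> i\<bar> = 1"
    and ok: "\<And>t. t < l \<Longrightarrow> growth_ok \<alpha> \<beta> B (Q * L * \<alpha> ^ t) (K1 + K2 * sqrt (L * (Q * L * \<alpha> ^ t))) \<sigma> H i t"
    and t: "t \<le> l"
  defines "E \<equiv> K1 + K2 * sqrt Q"
  defines "C \<equiv> Q + 1 + E / (\<alpha> - sqrt \<alpha>) + E / (\<beta> - sqrt \<alpha>)"
  shows "real (St H i t) \<le> C * L * \<alpha> ^ t"
    and "\<bar>real_of_int (Dt \<sigma> H i t)\<bar> \<le> C * L * \<beta> ^ t"
    and "\<bar>real (St H i t) - \<alpha> powr (real t - real l) * real (St H i l)\<bar> \<le> C * L * \<alpha> powr (real t / 2)"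
    and "\<bar>real_of_int (Dt \<sigma> H i t) - \<beta> powr (real t - real l) * real_of_int (Dt \<sigma> H i l)\<bar>
             \<le> C * L * \<alpha> powr (real t / 2)"
proof -
  define r where "r = sqrt \<alpha>"
  define S where "S = (\<lambda>t. real (St H i t))"
  define D where "D = (\<lambda>t. real_of_int (Dt \<sigma> H i t))"
  have r: "r \<ge> 1" "r < \<alpha>" using \<alpha> sqrt_less_self by (auto simp: r_def)
  \<comment> \<open>The form in which \<open>\<beta>\<^sup>2 > \<alpha>\<close> is used: it makes
    the denominator \<open>\<beta> - r\<close> positive.\<close>
  have r\<beta>: "r < \<beta>" unfolding r_def using \<alpha> \<beta> by (intro real_less_lsqrt) auto
  note Qb = growth_const_bound[OF \<alpha> K, folded Q]
  have E0: "E \<ge> 0" using K Qb by (simp add: E_def)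
  have S0: "S 0 = 1" and D0: "\<bar>D 0\<bar> = 1" using \<sigma> by (auto simp: S_def D_def St_def Dt_def)
  \<comment> \<open>The two factors \<open>L\<close> leave the square root as a single
    \<open>L\<close>, so the error carries one logarithm, as does the sphere bound that it must
    reproduce.\<close>
  have \<epsilon>: "K1 + K2 * sqrt (L * (Q * L * \<alpha> ^ t)) \<le> E * L * r ^ t" for t
  proof -
    have "L * (Q * L * \<alpha> ^ t) = Q * (L * L) * \<alpha> ^ t" by simp
    then have "sqrt (L * (Q * L * \<alpha> ^ t)) = sqrt Q * L * r ^ t"
      using L by (simp add: real_sqrt_mult real_sqrt_power r_def)
    moreover have "1 * 1 \<le> L * r ^ t" using L r by (intro mult_mono) auto
    then have "K1 * 1 \<le> K1 * (L * r ^ t)" using K by (intro mult_left_mono) auto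
    ultimately show ?thesis by (simp add: E_def algebra_simps)
  qed
  \<comment> \<open>Asks for the one-step bounds strictly below \<open>u\<close> only, so that the
    induction in \<open>step\<close> can use it at \<open>u\<close> itself.\<close>
  have small: "S u \<le> Q * L * \<alpha> ^ u" if "u \<le> l" "\<And>t. t < u \<Longrightarrow> \<bar>S (Suc t) - \<alpha> * S t\<bar> \<le> E * L * r ^ t" for u
  proof -
    have "\<bar>S u\<bar> \<le> (\<bar>S 0\<bar> + E * L / (\<alpha> - r)) * \<alpha> ^ u"
      by (rule perturbed_geometric_bounds(1)[where l = u]) (use r E0 L that in auto)
    also have "\<dots> \<le> (Q * L) * \<alpha> ^ u"
    proof (intro mult_right_mono)
      have "\<bar>S 0\<bar> + E * L / (\<alpha> - r) \<le> L * 1 + L * (E / (\<alpha> - r))" using S0 L by (simp add: mult.commute)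
      also have "\<dots> = L * (1 + E / (\<alpha> - r))" by (simp add: algebra_simps)
      also have "\<dots> \<le> L * Q" using Qb(2) L by (intro mult_left_mono) (auto simp: E_def r_def)
      finally show "\<bar>S 0\<bar> + E * L / (\<alpha> - r) \<le> Q * L" by (simp add: mult.commute)
    qed (use \<alpha> in auto)
    finally show ?thesis by simp
  qed
  have geo: "(\<Sum>r\<le>u. Q * L * \<alpha> ^ r) \<le> B" if "u < l" for u
  proof -
    have "(\<Sum>r\<le>u. Q * L * \<alpha> ^ r) = Q * L * (\<Sum>r<Suc u. \<alpha> ^ r)"
      by (simp add: sum_distrib_left lessThan_Suc_atMost)
    also have "(\<Sum>r<Suc u. \<alpha> ^ r) = (\<alpha> ^ Suc u - 1) / (\<alpha> - 1)"
      using \<alpha> by (intro geometric_sum) auto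
    also have "\<dots> \<le> \<alpha> ^ l / (\<alpha> - 1)"
    proof (intro divide_right_mono)
      have "\<alpha> ^ Suc u \<le> \<alpha> ^ l" using that \<alpha> by (intro power_increasing) auto
      then show "\<alpha> ^ Suc u - 1 \<le> \<alpha> ^ l" by simp
    qed (use \<alpha> in auto)
    finally show ?thesis using Qb(1) L B by (simp add: mult_left_mono order_trans)
  qed
  have step: "\<bar>S (Suc u) - \<alpha> * S u\<bar> \<le> E * L * r ^ u \<and> \<bar>D (Suc u) - \<beta> * D u\<bar> \<le> E * L * r ^ u"
    if "u < l" for u
    using that
  proof (induction u rule: less_induct)
    case (less u)
    have Sle: "S w \<le> Q * L * \<alpha> ^ w" if "w \<le> u" for w
      using less that by (intro small) auto
    then have "(\<Sum>r\<le>u. S r) \<le> (\<Sum>r\<le>u. Q * L * \<alpha> ^ r)" by (intro sum_mono) auto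
    also have "\<dots> \<le> B" by (rule geo[OF less.prems])
    finally show ?case
      using ok[OF less.prems] Sle[of u] \<epsilon>[of u] unfolding growth_ok_def S_def D_def by auto
  qed
  have cs: "E / (\<alpha> - r) \<ge> 0" "E / (\<beta> - r) \<ge> 0" using E0 r r\<beta> by auto
  have C: "C = Q + 1 + E / (\<alpha> - r) + E / (\<beta> - r)" by (simp add: C_def r_def)
  have rt: "\<alpha> powr (real t / 2) = r ^ t"
    using \<alpha> by (simp add: r_def powr_half_sqrt[symmetric] powr_powr flip: powr_realpow)
  have S_le: "S t \<le> Q * L * \<alpha> ^ t" using small[OF t] step t by auto
  also have "\<dots> \<le> C * L * \<alpha> ^ t"
    using \<alpha> L cs by (intro mult_right_mono) (auto simp: C)
  finally show "real (St H i t) \<le> C * L * \<alpha> ^ t" by (simp add: S_def)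
  have "\<bar>D t\<bar> \<le> (\<bar>D 0\<bar> + E * L / (\<beta> - r)) * \<beta> ^ t"
    by (rule perturbed_geometric_bounds(1)[where l = l]) (use r r\<beta> E0 L t step in auto)
  also have "\<dots> \<le> C * L * \<beta> ^ t"
  proof (intro mult_right_mono)
    have "\<bar>D 0\<bar> + E * L / (\<beta> - r) \<le> L * 1 + L * (E / (\<beta> - r))" using D0 L by (simp add: mult.commute)
    also have "\<dots> = (1 + E / (\<beta> - r)) * L" by (simp add: algebra_simps)
    also have "\<dots> \<le> C * L" using L cs Qb(1) by (intro mult_right_mono) (auto simp: C)
    finally show "\<bar>D 0\<bar> + E * L / (\<beta> - r) \<le> C * L" .
  qed (use \<beta> in auto)
  finally show "\<bar>real_of_int (Dt \<sigma> H i t)\<bar> \<le> C * L * \<beta> ^ t" by (simp add: D_def)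
  have "\<bar>S t - \<alpha> powr (real t - real l) * S l\<bar> \<le> E * L / (\<alpha> - r) * r ^ t"
    by (rule perturbed_geometric_bounds(2)) (use r E0 L t step in auto)
  also have "E * L / (\<alpha> - r) = E / (\<alpha> - r) * L" by simp
  also have "E / (\<alpha> - r) * L * r ^ t \<le> C * L * r ^ t"
    using L cs Qb(1) r by (intro mult_right_mono) (auto simp: C)
  finally show "\<bar>real (St H i t) - \<alpha> powr (real t - real l) * real (St H i l)\<bar> \<le> C * L * \<alpha> powr (real t / 2)"
    by (simp add: S_def rt)
  have "\<bar>D t - \<beta> powr (real t - real l) * D l\<bar> \<le> E * L / (\<beta> - r) * r ^ t"
    by (rule perturbed_geometric_bounds(2)) (use r r\<beta> E0 L t step in auto)
  also have "E * L / (\<beta> - r) = E / (\<beta> - r) * L" by simp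
  also have "E / (\<beta> - r) * L * r ^ t \<le> C * L * r ^ t"
    using L cs Qb(1) r by (intro mult_right_mono) (auto simp: C)
  finally show "\<bar>real_of_int (Dt \<sigma> H i t) - \<beta> powr (real t - real l) * real_of_int (Dt \<sigma> H i l)\<bar>
             \<le> C * L * \<alpha> powr (real t / 2)"
    by (simp add: D_def rt)
qed

section \<open>Concentration of the total spin\<close>

lemma spins_balanced:
  fixes n :: nat
  assumes "n \<ge> 3"
  shows "measure_pmf.prob (pmf_of_set (PiE {1..n} (\<lambda>_. {-1, 1::int})))
     {\<sigma>. \<not> \<bar>\<Sum>i\<in>{1..n}. real_of_int (\<sigma> i)\<bar> \<le> 3 * sqrt (real n * ln (real n))} \<le> 2 * real n powr (- 2)"
proof -
  \<comment> \<open>With this scale the second moments add up to ln n and the threshold becomes 3 ln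
    n, so each tail is at most \<open>n powr (- 2)\<close>.\<close>
  define \<theta> where "\<theta> = sqrt (ln (real n) / real n)"
  let ?p = "\<lambda>_::nat. pmf_of_set {-1, 1::int}"
  have ln0: "ln (real n) > 0" using assms by simp
  have \<theta>: "0 < \<theta>" "\<theta> \<le> 1"
    using ln0 assms ln_le_minus_one[of "real n"] by (auto simp: \<theta>_def)
  \<comment> \<open>Functions in \<open>PiE\<close> are \<open>undefined\<close> off the index set,
    which forces this default value.\<close>
  have eq: "pmf_of_set (PiE {1..n} (\<lambda>_. {-1, 1::int})) = Pi_pmf {1..n} undefined ?p"
  proof -
    have "PiE_dflt {1..n} undefined (\<lambda>_. {-1, 1::int}) = PiE {1..n} (\<lambda>_. {-1, 1})"
      by (auto simp: PiE_dflt_def PiE_def extensional_def)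
    then show ?thesis by (subst Pi_pmf_of_set) auto
  qed
  have E: "measure_pmf.expectation (?p i) (\<lambda>x. \<theta> * real_of_int x) = 0"
    "measure_pmf.expectation (?p i) (\<lambda>x. (\<theta> * real_of_int x)\<^sup>2) = \<theta>\<^sup>2" for i
    by (simp_all add: integral_pmf_of_set power_mult_distrib)
  have "measure_pmf.prob (Pi_pmf {1..n} undefined ?p)
     {\<sigma>. \<not> \<bar>\<Sum>i\<in>{1..n}. real_of_int (\<sigma> i)\<bar> \<le> 3 * sqrt (real n * ln (real n))}
    \<le> measure_pmf.prob (Pi_pmf {1..n} undefined ?p)
     {\<sigma>. \<bar>(\<Sum>i\<in>{1..n}. \<theta> * real_of_int (\<sigma> i)) - (\<Sum>i\<in>{1..n}. measure_pmf.expectation (?p i) (\<lambda>x. \<theta> * real_of_int x))\<bar> \<ge> 3 * ln (real n)}"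
  proof (intro measure_pmf.finite_measure_mono subsetI, unfold mem_Collect_eq)
    fix \<sigma> :: "nat \<Rightarrow> int" 
    let ?S = "\<Sum>i\<in>{1..n}. real_of_int (\<sigma> i)"
    assume "\<not> \<bar>?S\<bar> \<le> 3 * sqrt (real n * ln (real n))"
    then have "\<theta> * (3 * sqrt (real n * ln (real n))) \<le> \<theta> * \<bar>?S\<bar>"
      using \<theta> by (intro mult_left_mono) auto
    also have "\<theta> * (3 * sqrt (real n * ln (real n))) = 3 * sqrt (ln (real n) / real n * (real n * ln (real n)))"
      by (simp only: real_sqrt_mult \<theta>_def)
    also have "\<dots> = 3 * ln (real n)" using ln0 assms by simp
    also have "\<theta> * \<bar>?S\<bar> = \<bar>\<Sum>i\<in>{1..n}. \<theta> * real_of_int (\<sigma> i)\<bar>"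
      using \<theta> by (simp add: abs_mult flip: sum_distrib_left)
    finally show "3 * ln (real n) \<le> \<bar>(\<Sum>i\<in>{1..n}. \<theta> * real_of_int (\<sigma> i)) - (\<Sum>i\<in>{1..n}. measure_pmf.expectation (?p i) (\<lambda>x. \<theta> * real_of_int x))\<bar>"
      unfolding E by simp
  qed simp
  also have "\<dots> \<le> 2 * exp ((\<Sum>i\<in>{1..n}. measure_pmf.expectation (?p i) (\<lambda>x. (\<theta> * real_of_int x)\<^sup>2)) - 3 * ln (real n))"
    by (rule Pi_pmf_chernoff_abs) (use \<theta> in \<open>auto simp: set_pmf_of_set\<close>)
  also have "(\<Sum>i\<in>{1..n}. measure_pmf.expectation (?p i) (\<lambda>x. (\<theta> * real_of_int x)\<^sup>2)) = ln (real n)"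
    unfolding E using ln0 assms by (simp add: \<theta>_def)
  also have "exp (ln (real n) - 3 * ln (real n)) = real n powr (- 2)"
    using assms by (simp add: powr_def)
  finally show ?thesis unfolding eq .
qed

context balanced_hsbm
begin

lemma all_spheres:
  fixes B L :: real and m :: "nat \<Rightarrow> real"
  assumes B: "B\<^sup>2 \<le> real n" "B * (s + real d + 2) \<le> real n"
      "exp (real d + 1) * a * (real d)\<^sup>2 * B \<le> real n"
    and L: "0 < L" "\<And>t. t < l \<Longrightarrow> L \<le> m t"
  defines "\<epsilon> \<equiv> \<lambda>t. 4 * real d ^ 3 * a + (3 + (a + 3) * real d) * sqrt (L * m t)"
  shows "measure_pmf.prob M {\<omega>. \<exists>i\<in>{1..n}. \<exists>t<l. \<not> growth_ok (alpha d a b) (beta d a b) B (m t) (\<epsilon> t) \<sigma> {e\<in>ds. \<omega> e} i t}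
    \<le> real n * real l * (2 * (2 + exp (2 * exp (real d + 1) * (real d)\<^sup>2 * a\<^sup>2)) * exp (- 3 * L))"
proof -
  let ?b = "2 * (2 + exp (2 * exp (real d + 1) * (real d)\<^sup>2 * a\<^sup>2)) * exp (- 3 * L)"
  let ?X = "\<lambda>it. {\<omega>. \<not> growth_ok (alpha d a b) (beta d a b) B (m (snd it)) (\<epsilon> (snd it)) \<sigma> {e\<in>ds. \<omega> e} (fst it) (snd it)}"
  have "{\<omega>. \<exists>i\<in>{1..n}. \<exists>t<l. \<not> growth_ok (alpha d a b) (beta d a b) B (m t) (\<epsilon> t) \<sigma> {e\<in>ds. \<omega> e} i t}
      = (\<Union>it\<in>{1..n} \<times> {..<l}. ?X it)" by force
  then have "measure_pmf.prob M {\<omega>. \<exists>i\<in>{1..n}. \<exists>t<l. \<not> growth_ok (alpha d a b) (beta d a b) B (m t) (\<epsilon> t) \<sigma> {e\<in>ds. \<omega> e} i t}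
      = measure_pmf.prob M (\<Union>it\<in>{1..n} \<times> {..<l}. ?X it)" by (rule arg_cong)
  also have "\<dots> \<le> (\<Sum>it\<in>{1..n} \<times> {..<l}. measure_pmf.prob M (?X it))"
    by (intro measure_pmf.finite_measure_subadditive_finite) auto
  also have "\<dots> \<le> (\<Sum>it\<in>{1..n} \<times> {..<l}. ?b)"
  proof (intro sum_mono)
    fix it assume "it \<in> {1..n} \<times> {..<l}"
    then show "measure_pmf.prob M (?X it) \<le> ?b"
      unfolding \<epsilon>_def by (intro sphere_step B L) auto
  qed
  finally show ?thesis by (simp add: card_cartesian_product)
qed

end

section \<open>Union bound over centres and radii\<close>

text \<open>The bound \<open>n choose k >= (n / k) ^ k\<close> at \<open>k = d - 1\<close> suffices:
  as \<open>n / k >= 1\<close>, the power is at least \<open>n / k\<close>, which is at least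
  \<open>a\<close>.\<close>

lemma pn_le_1_large:
  assumes "d \<ge> 3" "n \<ge> 2 * d" "a * real d \<le> real n"
  shows "pn n d a \<le> 1"
proof -
  have d0: "real (d - 1) > 0" using assms by simp
  have "a * real (d - 1) \<le> real n"
  proof (cases "a \<ge> 0")
    case True
    then have "a * real (d - 1) \<le> a * real d" by (intro mult_left_mono) auto
    with assms(3) show ?thesis by simp
  next
    case False
    then have "a * real (d - 1) \<le> 0" using d0 by (intro mult_nonpos_nonneg) auto
    then show ?thesis by (rule order_trans) simp
  qed
  then have "a \<le> real n / real (d - 1)" using d0 by (simp add: pos_le_divide_eq)
  also have "\<dots> \<le> (real n / real (d - 1)) ^ (d - 1)"
    using assms d0 by (intro self_le_power) (auto simp: pos_le_divide_eq)
  also have "\<dots> \<le> real (n choose (d - 1))"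
    using assms by (intro binomial_ge_n_over_k_pow_k) auto
  finally show ?thesis using assms by (simp add: pn_def)
qed

theorem theorem4p2:
  fixes d :: nat and a b c :: real
  assumes "d \<ge> 3" and "a \<ge> b" and "b > 0"
    and "beta d a b ^ 2 > alpha d a b" and "alpha d a b > 1"
    and "c * ln (alpha d a b) < 1 / 4"
  shows "\<exists>C \<gamma> K N. C > 0 \<and> \<gamma> > 0 \<and> K > 0 \<and> (\<forall>n\<ge>N.
     let l = nat \<lfloor>c * ln (real n)\<rfloor>; \<alpha> = alpha d a b; \<beta> = beta d a b in
     measure_pmf.prob (HSBM n d a b)
       {(\<sigma>, H). \<forall>i\<in>{1..n}. \<forall>t. 1 \<le> t \<and> t \<le> l \<longrightarrow>
          real (St H i t) \<le> C * ln (real n) * \<alpha> ^ t \<and>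
          \<bar>real_of_int (Dt \<sigma> H i t)\<bar> \<le> C * ln (real n) * \<beta> ^ t \<and>
          \<bar>real (St H i t) - \<alpha> powr (real t - real l) * real (St H i l)\<bar>
             \<le> C * ln (real n) * \<alpha> powr (real t / 2) \<and>
          \<bar>real_of_int (Dt \<sigma> H i t) - \<beta> powr (real t - real l) * real_of_int (Dt \<sigma> H i l)\<bar>
             \<le> C * ln (real n) * \<alpha> powr (real t / 2)}
     \<ge> 1 - K * real n powr (- \<gamma>))"
proof -
  define \<alpha> \<beta> where "\<alpha> = alpha d a b" and "\<beta> = beta d a b"
  define K1 K2 where "K1 = 4 * real d ^ 3 * a" and "K2 = 3 + (a + 3) * real d"
  define Q where "Q = growth_const \<alpha> K1 K2"
  define E where "E = K1 + K2 * sqrt Q"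
  define C where "C = Q + 1 + E / (\<alpha> - sqrt \<alpha>) + E / (\<beta> - sqrt \<alpha>)"
  \<comment> \<open>Bounds every ball of radius below \<open>l\<close>: the sphere bounds sum
    geometrically to at most \<open>Q * ln n * \<alpha> ^ l / (\<alpha> - 1)\<close>, and
    \<open>\<alpha> ^ l <= n powr (1 / 4)\<close>.\<close>
  define B where "B = (\<lambda>x. Q / (\<alpha> - 1) * ln x * x powr (1 / 4))"
  define s where "s = (\<lambda>x. 3 * sqrt (x * ln x))"
  define G where "G = exp (real d + 1) * a * (real d)\<^sup>2"
  define K where "K = 2 * (2 + exp (2 * exp (real d + 1) * (real d)\<^sup>2 * a\<^sup>2))"
  have a0: "a > 0" and d0: "real d > 0" using assms by auto
  have \<alpha>1: "\<alpha> > 1" and \<beta>2: "\<beta>\<^sup>2 > \<alpha>" using assms by (auto simp: \<alpha>_def \<beta>_def)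
  have "\<beta> \<ge> 0" using assms by (simp add: \<beta>_def beta_def)
  moreover have "\<beta> \<noteq> 0" using \<beta>2 \<alpha>1 by auto
  ultimately have \<beta>0: "\<beta> > 0" by simp
  have K0: "K1 \<ge> 0" "K2 \<ge> 0" using a0 by (auto simp: K1_def K2_def)
  have Q1: "Q \<ge> 1" unfolding Q_def by (rule growth_const_bound[OF \<alpha>1 K0])
  have r\<beta>: "sqrt \<alpha> < \<beta>" using \<alpha>1 \<beta>2 \<beta>0 by (intro real_less_lsqrt) auto
  have E0: "E \<ge> 0" using K0 Q1 by (simp add: E_def)
  have C0: "C > 0"
    using Q1 E0 r\<beta> sqrt_less_self[OF \<alpha>1] unfolding C_def by (intro add_pos_nonneg) auto
  define R where "R = Q / (\<alpha> - 1)"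
  have R0: "R > 0" using Q1 \<alpha>1 by (simp add: R_def)
  have G0: "G > 0" using a0 d0 by (simp add: G_def)
  \<comment> \<open>A positive constant above \<open>c\<close>, from which \<open>l n <= n\<close>
    follows whatever the sign of \<open>c\<close>.\<close>
  define c' where "c' = \<bar>c\<bar> + 1"
  have c': "c' > 0" by (simp add: c'_def)
  have "eventually (\<lambda>x. ln x \<ge> 1) (at_top :: real filter)" by real_asymp
  moreover have "eventually (\<lambda>x. x \<ge> s x + 2 * real d) at_top" unfolding s_def by real_asymp
  moreover have "eventually (\<lambda>x. x \<ge> a * real d) at_top" by real_asymp
  \<comment> \<open>This and the next two limits are the size conditions of
    \<open>offspring_concentration\<close>: few pairs inside the ball, small bias from the spin
    imbalance, small collision rate. Up to logarithms the left sides are the powers 1/2, 3/4 and 1/4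
    of \<open>x\<close>.\<close>
  moreover have "eventually (\<lambda>x. (B x)\<^sup>2 \<le> x) at_top"
    unfolding B_def R_def[symmetric] using R0 by real_asymp
  moreover have "eventually (\<lambda>x. B x * (s x + real d + 2) \<le> x) at_top"
    unfolding B_def s_def R_def[symmetric] using R0 d0 by real_asymp
  moreover have "eventually (\<lambda>x. G * B x \<le> x) at_top"
    unfolding B_def R_def[symmetric] using R0 G0 by real_asymp
  moreover have "eventually (\<lambda>x. c' * ln x \<le> x) at_top"
    using c' by real_asymp
  ultimately have "eventually (\<lambda>x. ln x \<ge> 1 \<and> x \<ge> s x + 2 * real d \<and> x \<ge> a * real d \<and> (B x)\<^sup>2 \<le> x \<and>
      B x * (s x + real d + 2) \<le> x \<and> G * B x \<le> x \<and> c' * ln x \<le> x) at_top"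
    by (intro eventually_conj)
  then have "eventually (\<lambda>n. ln (real n) \<ge> 1 \<and> real n \<ge> s n + 2 * real d \<and> real n \<ge> a * real d \<and>
      (B n)\<^sup>2 \<le> real n \<and> B n * (s n + real d + 2) \<le> real n \<and> G * B n \<le> real n \<and> c' * ln (real n) \<le> real n) sequentially"
    using filterlim_real_sequentially by (rule eventually_compose_filterlim)
  then obtain N where N: "\<And>n. n \<ge> N \<Longrightarrow> ln (real n) \<ge> 1 \<and> real n \<ge> s n + 2 * real d \<and> real n \<ge> a * real d \<and>
      (B n)\<^sup>2 \<le> real n \<and> B n * (s n + real d + 2) \<le> real n \<and> G * B n \<le> real n \<and> c' * ln (real n) \<le> real n"
    unfolding eventually_sequentially by blast
  define l where "l = (\<lambda>n::nat. nat \<lfloor>c * ln (real n)\<rfloor>)"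
  define ev where "ev = (\<lambda>n. {(\<sigma>, H). \<forall>i\<in>{1..n}. \<forall>t. 1 \<le> t \<and> t \<le> l n \<longrightarrow>
          real (St H i t) \<le> C * ln (real n) * \<alpha> ^ t \<and>
          \<bar>real_of_int (Dt \<sigma> H i t)\<bar> \<le> C * ln (real n) * \<beta> ^ t \<and>
          \<bar>real (St H i t) - \<alpha> powr (real t - real (l n)) * real (St H i (l n))\<bar>
             \<le> C * ln (real n) * \<alpha> powr (real t / 2) \<and>
          \<bar>real_of_int (Dt \<sigma> H i t) - \<beta> powr (real t - real (l n)) * real_of_int (Dt \<sigma> H i (l n))\<bar>
             \<le> C * ln (real n) * \<alpha> powr (real t / 2)})"
  have main: "measure_pmf.prob (HSBM n d a b) (ev n) \<ge> 1 - (K + 2) * real n powr (- 1)" if "n \<ge> N" for n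
  proof -
    define L where "L = ln (real n)"
    have big: "L \<ge> 1" "real n \<ge> s n + 2 * real d" "real n \<ge> a * real d"
      "(B n)\<^sup>2 \<le> real n" "B n * (s n + real d + 2) \<le> real n" "G * B n \<le> real n" "c' * L \<le> real n"
      using N[OF that] by (auto simp: L_def)
    have s0: "s n \<ge> 0" using big(1) by (simp add: s_def L_def)
    have "real (2 * d) \<le> real n" using big(2) s0 by simp
    then have n2d: "2 * d \<le> n" by (simp only: of_nat_le_iff)
    then have n3: "n \<ge> 3" using assms(1) by simp
    have l_real: "real (l n) \<le> max 0 (c * L)" unfolding l_def L_def by linarith
    have l_le: "real (l n) \<le> real n"
    proof -
      have "c * L \<le> c' * L" using big(1) by (intro mult_right_mono) (auto simp: c'_def)
      with l_real big(7) show ?thesis by linarith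
    qed
    \<comment> \<open>The bound on \<open>c * ln \<alpha>\<close> is used here. The maximum with 0
      covers negative \<open>c\<close>, for which \<open>nat\<close> makes \<open>l n\<close>
      zero.\<close>
    have \<alpha>l: "\<alpha> ^ l n \<le> real n powr (1 / 4)"
    proof -
      have "real (l n) * ln \<alpha> \<le> max 0 (c * L) * ln \<alpha>" using \<alpha>1 l_real by (intro mult_right_mono) auto
      also have "\<dots> \<le> 1 / 4 * L"
      proof (cases "c * L \<ge> 0")
        case True
        have "c * ln \<alpha> * L \<le> 1 / 4 * L" using assms(6) big(1) by (intro mult_right_mono) (auto simp: \<alpha>_def)
        with True show ?thesis by (simp add: mult_ac)
      qed (use big(1) in auto)
      finally have "exp (real (l n) * ln \<alpha>) \<le> exp (1 / 4 * L)" by simp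
      also have "exp (real (l n) * ln \<alpha>) = \<alpha> ^ l n" using \<alpha>1 by (simp add: exp_of_nat_mult)
      also have "exp (1 / 4 * L) = real n powr (1 / 4)" using n3 by (simp add: powr_def L_def)
      finally show ?thesis .
    qed
    have Bl: "Q * L * \<alpha> ^ l n / (\<alpha> - 1) \<le> B n"
    proof -
      have "Q * L * \<alpha> ^ l n / (\<alpha> - 1) = (Q / (\<alpha> - 1) * L) * \<alpha> ^ l n" by simp
      also have "\<dots> \<le> (Q / (\<alpha> - 1) * L) * real n powr (1 / 4)"
        using Q1 \<alpha>1 big(1) by (intro mult_left_mono \<alpha>l) auto
      finally show ?thesis by (simp add: B_def L_def)
    qed
    have e3: "exp (- 3 * L) = real n powr (- 3)" using n3 by (simp add: powr_def L_def)
    \<comment> \<open>Given balanced spins and all one-step estimates, the conclusion is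
      deterministic; failure is charged to unbalanced spins or to a failing step at some centre and
      some radius below \<open>l n\<close>.\<close>
    have "measure_pmf.prob (HSBM n d a b) (- ev n) \<le>
        measure_pmf.prob (pmf_of_set (PiE {1..n} (\<lambda>_. {-1, 1::int}))) {\<sigma>. \<not> \<bar>\<Sum>i\<in>{1..n}. real_of_int (\<sigma> i)\<bar> \<le> s n}
        + real n * real (l n) * (K * exp (- 3 * L))"
      unfolding HSBM_def
    proof (rule prob_bind_pmf_le)
      have fin: "finite (PiE {1..n} (\<lambda>_. {-1, 1::int}))" by (intro finite_PiE) auto
      have ne: "PiE {1..n} (\<lambda>_. {-1, 1::int}) \<noteq> {}" by (simp add: PiE_eq_empty_iff)
      show "finite (set_pmf (pmf_of_set (PiE {1..n} (\<lambda>_. {-1, 1::int}))))"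
        using fin ne by simp
      show "0 \<le> real n * real (l n) * (K * exp (- 3 * L))" by (simp add: K_def add_nonneg_nonneg)
      fix \<sigma> assume \<sigma>: "\<sigma> \<in> set_pmf (pmf_of_set (PiE {1..n} (\<lambda>_. {-1, 1::int})))"
        "\<sigma> \<notin> {\<sigma>. \<not> \<bar>\<Sum>i\<in>{1..n}. real_of_int (\<sigma> i)\<bar> \<le> s n}"
      have spin: "\<sigma> i = 1 \<or> \<sigma> i = -1" if "i \<in> {1..n}" for i
      proof -
        have "\<sigma> \<in> PiE {1..n} (\<lambda>_. {-1, 1::int})" using \<sigma>(1) fin ne by simp
        from PiE_mem[OF this that] show ?thesis by auto
      qed
      interpret balanced_hsbm n d a b "s n" \<sigma>
        by unfold_locales (use assms big s0 n2d \<sigma>(2) spin pn_le_1_large[of d n a] in auto)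
      let ?H = "\<lambda>\<omega>. {e \<in> dsubsets n d. \<omega> e}"
      let ?m = "\<lambda>t. Q * L * \<alpha> ^ t"
      let ?\<epsilon> = "\<lambda>t. 4 * real d ^ 3 * a + (3 + (a + 3) * real d) * sqrt (L * ?m t)"
      have "measure_pmf.prob (do { f \<leftarrow> Pi_pmf (dsubsets n d) False
                 (\<lambda>e. bernoulli_pmf (if spins_agree \<sigma> e then pn n d a else pn n d b));
          return_pmf (\<sigma>, {e \<in> dsubsets n d. f e}) }) (- ev n) = measure_pmf.prob M {\<omega>. (\<sigma>, ?H \<omega>) \<notin> ev n}"
        unfolding P_def map_pmf_def[symmetric] by (simp add: vimage_def)
      also have "\<dots> \<le> measure_pmf.prob M {\<omega>. \<exists>i\<in>{1..n}. \<exists>t<l n.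
           \<not> growth_ok (alpha d a b) (beta d a b) (B n) (?m t) (?\<epsilon> t) \<sigma> (?H \<omega>) i t}"
      proof (intro measure_pmf.finite_measure_mono subsetI, unfold mem_Collect_eq, rule ccontr)
        fix \<omega>
        assume bad: "(\<sigma>, ?H \<omega>) \<notin> ev n"
          and "\<not> (\<exists>i\<in>{1..n}. \<exists>t<l n. \<not> growth_ok (alpha d a b) (beta d a b) (B n) (?m t) (?\<epsilon> t) \<sigma> (?H \<omega>) i t)"
        then have ok: "growth_ok \<alpha> \<beta> (B n) (?m t) (K1 + K2 * sqrt (L * ?m t)) \<sigma> (?H \<omega>) i t"
          if "i \<in> {1..n}" "t < l n" for i t
          using that unfolding \<alpha>_def \<beta>_def K1_def K2_def by blast
        have "(\<sigma>, ?H \<omega>) \<in> ev n"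
          unfolding ev_def mem_Collect_eq prod.case L_def[symmetric]
        proof (intro ballI allI impI, elim conjE)
          fix i t assume i: "i \<in> {1..n}" and t: "t \<le> l n"
          have \<sigma>i: "\<bar>\<sigma> i\<bar> = 1" using spin[OF i] by auto
          note * = growth_ok_imp[OF \<alpha>1 \<beta>0 \<beta>2 big(1) K0 Q_def Bl \<sigma>i ok[OF i] t, folded E_def, folded C_def]
          show "real (St (?H \<omega>) i t) \<le> C * L * \<alpha> ^ t \<and>
            \<bar>real_of_int (Dt \<sigma> (?H \<omega>) i t)\<bar> \<le> C * L * \<beta> ^ t \<and>
            \<bar>real (St (?H \<omega>) i t) - \<alpha> powr (real t - real (l n)) * real (St (?H \<omega>) i (l n))\<bar>
               \<le> C * L * \<alpha> powr (real t / 2) \<and>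
            \<bar>real_of_int (Dt \<sigma> (?H \<omega>) i t) - \<beta> powr (real t - real (l n)) * real_of_int (Dt \<sigma> (?H \<omega>) i (l n))\<bar>
               \<le> C * L * \<alpha> powr (real t / 2)"
            using * by blast
        qed
        with bad show False by contradiction
      qed simp
      also have "\<dots> \<le> real n * real (l n) * (K * exp (- 3 * L))"
        unfolding K_def
      proof (rule all_spheres)
        show "exp (real d + 1) * a * (real d)\<^sup>2 * B n \<le> real n" using big(6) by (simp add: G_def)
        fix t
        have "1 * 1 \<le> Q * \<alpha> ^ t" using Q1 \<alpha>1 by (intro mult_mono) auto
        then have "L * 1 \<le> L * (Q * \<alpha> ^ t)" using big(1) by (intro mult_left_mono) auto
        then show "L \<le> ?m t" by (simp add: mult_ac)
      qed (use big in auto)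
      finally show "measure_pmf.prob (do { f \<leftarrow> Pi_pmf (dsubsets n d) False
                 (\<lambda>e. bernoulli_pmf (if spins_agree \<sigma> e then pn n d a else pn n d b));
          return_pmf (\<sigma>, {e \<in> dsubsets n d. f e}) }) (- ev n) \<le> real n * real (l n) * (K * exp (- 3 * L))" .
    qed
    also have "\<dots> \<le> 2 * real n powr (- 1) + K * real n powr (- 1)"
    proof (rule add_mono)
      have "measure_pmf.prob (pmf_of_set (PiE {1..n} (\<lambda>_. {-1, 1::int}))) {\<sigma>. \<not> \<bar>\<Sum>i\<in>{1..n}. real_of_int (\<sigma> i)\<bar> \<le> s n}
         \<le> 2 * real n powr (- 2)" unfolding s_def by (rule spins_balanced[OF n3])
      also have "\<dots> \<le> 2 * real n powr (- 1)" using n3 by (intro mult_left_mono powr_mono) auto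
      finally show "measure_pmf.prob (pmf_of_set (PiE {1..n} (\<lambda>_. {-1, 1::int}))) {\<sigma>. \<not> \<bar>\<Sum>i\<in>{1..n}. real_of_int (\<sigma> i)\<bar> \<le> s n}
         \<le> 2 * real n powr (- 1)" .
      \<comment> \<open>The crude bound \<open>l n <= n\<close> is enough: the \<open>n * n\<close>
        pairs of centre and radius are outweighed by \<open>n powr (- 3)\<close>, which leaves the
        exponent -1.\<close>
      have "real n * real (l n) * (K * exp (- 3 * L)) \<le> real n * real n * (K * exp (- 3 * L))"
        by (intro mult_right_mono mult_left_mono l_le) (auto simp: K_def add_nonneg_nonneg)
      also have "\<dots> = K * (real n powr 2 * real n powr (- 3))"
        unfolding e3 using n3 by (simp add: power2_eq_square)
      also have "real n powr 2 * real n powr (- 3) = real n powr (- 1)"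
        unfolding powr_add[symmetric] by simp
      finally show "real n * real (l n) * (K * exp (- 3 * L)) \<le> K * real n powr (- 1)" .
    qed
    finally have "measure_pmf.prob (HSBM n d a b) (- ev n) \<le> (K + 2) * real n powr (- 1)"
      by (simp only: distrib_right add.commute)
    moreover have "measure_pmf.prob (HSBM n d a b) (- ev n) = 1 - measure_pmf.prob (HSBM n d a b) (ev n)"
      using measure_pmf.prob_compl[of "ev n" "HSBM n d a b"] by (simp add: Compl_eq_Diff_UNIV)
    ultimately show ?thesis by linarith
  qed
  have "K > 0" unfolding K_def by (intro mult_pos_pos add_pos_pos) auto
  then have "K + 2 > 0" by simp
  then show ?thesis
    using C0 main unfolding ev_def l_def \<alpha>_def \<beta>_def Let_def
    by (intro exI[of _ C] exI[of _ "1::real"] exI[of _ "K + 2"] exI[of _ N] conjI allI impI) auto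
qed

end
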